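(* Let $q\ge2$ be an integer and let $f\colon\mathbb{N}_0\to\mathbb{U}$ be a $q$-multiplicative sequence of Gelfond type, i.e. there exists $c>0$ with $\sup_{\alpha\in\mathbb{R}}\big|\frac1N\sum_{n=0}^{N-1}f(n)e(n\alpha)\big|\ll N^{-c}$ for $N\ge1$. Then for every real polynomial $p$ with $p(\mathbb{N}_0)\subset\mathbb{N}_0$, every measure-preserving system $(X,\mathcal{B},T,\mu)$ and every $F\in L^r(\mu)$ for some $r>1$, $$\lim_{N\to\infty}\frac1N\sum_{n=0}^{N-1}f(n)F(T^{p(n)}x)=0\quad\text{for $\mu$-almost all }x\in X.$$
   Context: $\mathbb{N}_0=\{0,1,2,\dots\}$, $\mathbb{U}=\{z\in\mathbb{C}:|z|=1\}$, $e(t)=e^{2\pi i t}$. A sequence $f\colon\mathbb{N}_0\to\mathbb{U}$ is $q$-multiplicative if for all integers $t,m,n\ge 0$ with $m<q^t$ and $q^t\mid n$ one has $f(m+n)=f(m)f(n)$. $X\ll Y$ means $|X|\le CY$ for a constant $C$ independent of $N$. *)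

theory Defs
  imports "HOL-Probability.Probability" "HOL-Computational_Algebra.Polynomial"
begin

definition e :: "real \<Rightarrow> complex" where
  "e t = exp (2 * of_real pi * \<i> * of_real t)"

definition q_multiplicative :: "nat \<Rightarrow> (nat \<Rightarrow> complex) \<Rightarrow> bool" where
  "q_multiplicative q f \<longleftrightarrow>
     (\<forall>t m n. m < q ^ t \<and> q ^ t dvd n \<longrightarrow> f (m + n) = f m * f n)"

definition gelfond_type :: "(nat \<Rightarrow> complex) \<Rightarrow> bool" where
  "gelfond_type f \<longleftrightarrow>
     (\<exists>c>0. \<exists>C. \<forall>N\<ge>1. \<forall>\<alpha>::real.
        norm ((1 / of_nat N) * (\<Sum>n<N. f n * e (real n * \<alpha>))) \<le> C * real N powr (- c))"

definition mps :: "'a measure \<Rightarrow> ('a \<Rightarrow> 'a) \<Rightarrow> bool" where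
  "mps M T \<longleftrightarrow> prob_space M \<and> T \<in> measurable M M \<and> distr M M T = M"

end

theory Submission
  imports Defs
begin

text \<open>Exponential sums \<open>\<Sum>n<Q^L. f n * e (P n)\<close> have a power saving, uniformly over real polynomials
  \<open>P\<close> of bounded degree. Van der Corput differencing bounds such a sum by a Gowers-type average of \<open>f\<close>
  over cubes, which is a product of transfer operators, one for each base-\<open>Q\<close> digit, acting on
  vectors of carries. A digit block contributes a contraction unless \<open>f\<close> is close there to a
  polynomial phase; in that case \<open>q\<close>-multiplicativity makes \<open>f\<close> close to a linear phase on the upper
  digits of the block. If few blocks were contracting, concatenating these linear phases would give a
  frequency violating the Gelfond bound.

  Averaging along orbits transfers the power saving to \<open>L\<^sup>2(\<mu>)\<close>. At scale \<open>Q^(2j)\<close> the function \<open>F\<close> is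
  truncated at height \<open>\<mu>^j\<close>: the unbounded part is small in \<open>L\<^sup>1\<close> since \<open>r > 1\<close>, and the bounded part is
  summed over blocks of length \<open>Q^j\<close>, which controls all partial sums up to \<open>Q^(2j)\<close> at once. The
  resulting maximal bounds are summable over \<open>j\<close>, so no maximal ergodic theorem is needed.\<close>

subsection \<open>Exponential sums on finite cyclic groups\<close>

lemma e_add: "e (a + b) = e a * e b"
  by (simp add: e_def exp_add[symmetric] algebra_simps)

lemma e_0 [simp]: "e 0 = 1"
  by (simp add: e_def)

lemma e_eq_cis: "e t = cis (2 * pi * t)"
  by (simp add: e_def cis_conv_exp mult_ac)

lemma norm_e [simp]: "norm (e t) = 1"
  by (simp add: e_eq_cis)

lemma cnj_e: "cnj (e t) = e (- t)"
  by (simp add: e_eq_cis cis_cnj)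

lemma e_diff: "e (a - b) = e a * cnj (e b)"
  unfolding cnj_e e_add[symmetric] by simp

lemma e_of_nat_mult: "e (real n * t) = e t ^ n"
  by (simp add: e_eq_cis Complex.DeMoivre mult_ac)

lemma e_eq_1_iff: "e t = 1 \<longleftrightarrow> t \<in> \<int>"
proof
  assume "e t = 1"
  then obtain n :: int where "2 * pi * t = of_int (2 * n) * pi"
    by (auto simp: e_def exp_eq_1 mult_ac)
  then have "t = of_int n" by simp
  then show "t \<in> \<int>" by simp
next
  assume "t \<in> \<int>"
  then show "e t = 1" by (auto simp: e_eq_cis elim!: Ints_cases)
qed

lemma e_Ints: "t \<in> \<int> \<Longrightarrow> e t = 1"
  by (simp add: e_eq_1_iff)

lemma unimodular_e:
  assumes "norm z = 1"
  obtains t where "z = e t"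
proof -
  have "cis (Arg z) = z" using rcis_cmod_Arg[of z] assms by (simp add: rcis_def)
  then have "z = e (Arg z / (2 * pi))" unfolding e_eq_cis by simp
  then show ?thesis using that by blast
qed

lemma cnj_mult_unimodular: "norm z = 1 \<Longrightarrow> z * cnj z = 1"
  by (metis complex_norm_square of_real_1 power_one)

lemma dft_orthogonality:
  assumes "R > 0" "l < R" "l' < R"
  shows "(\<Sum>j<R. e (real l * real j / real R) * cnj (e (real l' * real j / real R)))
           = (if l = l' then of_nat R else 0)"
proof -
  define t where "t = (real l - real l') / real R"
  have eq: "e (real l * real j / real R) * cnj (e (real l' * real j / real R)) = e t ^ j" for j
    by (simp add: cnj_e e_add[symmetric] e_of_nat_mult[symmetric] t_def diff_divide_distrib algebra_simps)
  show ?thesis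
  proof (cases "l = l'")
    case True
    then show ?thesis by (simp add: cnj_mult_unimodular)
  next
    case False
    have "e t \<noteq> 1"
    proof
      assume "e t = 1"
      then obtain n where n: "t = of_int n" by (auto simp: e_eq_1_iff elim: Ints_cases)
      have "real_of_int (int l - int l') = of_int (n * int R)"
        using n assms by (simp add: t_def field_simps)
      then have "int l - int l' = n * int R" by linarith
      moreover have "\<bar>int l - int l'\<bar> < int R" using assms by linarith
      ultimately have "int l - int l' = 0"
        using dvd_imp_le_int[of "int l - int l'" "int R"] by fastforce
      then show False using False by simp
    qed
    moreover have "e t ^ R = 1"
      using assms by (simp add: e_of_nat_mult[symmetric] t_def e_eq_1_iff)
    ultimately show ?thesis
      using False by (simp add: eq geometric_sum)
  qed
qed

lemma parseval_dft:
  assumes "R > 0"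
  shows "(\<Sum>j<R. norm (\<Sum>l<R. c l * e (real l * real j / real R)) ^ 2)
           = real R * (\<Sum>l<R. norm (c l) ^ 2)"
proof -
  let ?E = "\<lambda>l j. e (real l * real j / real R)"
  have "complex_of_real (\<Sum>j<R. norm (\<Sum>l<R. c l * ?E l j) ^ 2)
      = (\<Sum>j<R. (\<Sum>l<R. c l * ?E l j) * cnj (\<Sum>l<R. c l * ?E l j))"
    by (simp only: of_real_sum complex_norm_square)
  also have "\<dots> = (\<Sum>j<R. \<Sum>l<R. \<Sum>l'<R. (c l * cnj (c l')) * (?E l j * cnj (?E l' j)))"
    by (simp add: sum_product cnj_sum mult_ac)
  also have "\<dots> = (\<Sum>l<R. \<Sum>l'<R. \<Sum>j<R. (c l * cnj (c l')) * (?E l j * cnj (?E l' j)))"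
    by (subst sum.swap, rule sum.cong[OF refl], subst sum.swap) (rule refl)
  also have "\<dots> = (\<Sum>l<R. \<Sum>l'<R. (c l * cnj (c l')) * (if l = l' then of_nat R else 0))"
    using assms by (intro sum.cong refl) (simp add: sum_distrib_left[symmetric] dft_orthogonality del: complex_cnj_divide)
  also have "\<dots> = (\<Sum>l<R. c l * cnj (c l) * of_nat R)"
    by (intro sum.cong refl) (simp add: if_distrib cong: if_cong)
  also have "\<dots> = complex_of_real (real R * (\<Sum>l<R. norm (c l) ^ 2))"
    by (simp only: of_real_mult of_real_sum complex_norm_square sum_distrib_left of_real_of_nat_eq mult_ac)
  finally show ?thesis by (simp only: of_real_eq_iff)
qed

lemma inverse_dft:
  assumes "R > 0" "l < R"
  shows "(\<Sum>j<R. (\<Sum>m<R. g m * cnj (e (real m * real j / real R))) * e (real l * real j / real R))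
          = of_nat R * g l"
proof -
  let ?E = "\<lambda>l j. e (real l * real j / real R)"
  have "(\<Sum>j<R. (\<Sum>m<R. g m * cnj (?E m j)) * ?E l j) = (\<Sum>m<R. g m * (\<Sum>j<R. ?E l j * cnj (?E m j)))"
    unfolding sum_distrib_right sum_distrib_left by (subst sum.swap) (simp add: mult_ac)
  also have "\<dots> = (\<Sum>m<R. g m * (if l = m then of_nat R else 0))"
    using assms by (intro sum.cong refl) (simp add: dft_orthogonality)
  also have "\<dots> = of_nat R * g l"
    using assms by (simp add: if_distrib cong: if_cong)
  finally show ?thesis .
qed

text \<open>Correlating with \<open>a\<close> along \<open>p\<close> is a Fourier multiplier on the
  cyclic group of order \<open>R\<close>: at frequency j/R the multiplier is an exponential sum of
  size at most \<open>\<Lambda>\<close>, and Parseval is used on both sides. The range condition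
  prevents wrap-around modulo \<open>R\<close>.\<close>

lemma convolution_bound_l2:
  fixes a g :: "nat \<Rightarrow> complex" and p :: "nat \<Rightarrow> nat"
  assumes bound: "\<And>\<alpha>. norm (\<Sum>n<N. a n * e (real (p n) * \<alpha>)) \<le> \<Lambda>"
    and range: "\<And>n l. n < N \<Longrightarrow> l < L \<Longrightarrow> l + p n < R" and "L \<le> R" "R > 0"
  shows "(\<Sum>l<L. norm (\<Sum>n<N. a n * g (l + p n)) ^ 2) \<le> \<Lambda>\<^sup>2 * (\<Sum>l<R. norm (g l) ^ 2)"
proof -
  let ?E = "\<lambda>l j. e (real l * real j / real R)"
  define G where "G j = (\<Sum>m<R. g m * cnj (?E m j))" for j
  define m where "m j = (\<Sum>n<N. a n * ?E (p n) j)" for j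
  have conv: "of_nat R * (\<Sum>n<N. a n * g (l + p n)) = (\<Sum>j<R. (G j * m j) * ?E j l)" if "l < L" for l
  proof -
    have "of_nat R * (\<Sum>n<N. a n * g (l + p n)) = (\<Sum>n<N. a n * (of_nat R * g (l + p n)))"
      by (simp add: sum_distrib_left mult_ac)
    also have "\<dots> = (\<Sum>n<N. a n * (\<Sum>j<R. G j * ?E (l + p n) j))"
      using that range \<open>R > 0\<close> unfolding G_def
      by (intro sum.cong refl arg_cong[where f="\<lambda>x. a _ * x"]) (rule inverse_dft[symmetric]; auto)
    also have "\<dots> = (\<Sum>j<R. (G j * m j) * ?E j l)"
      unfolding m_def sum_distrib_left sum_distrib_right
      by (subst sum.swap, intro sum.cong refl)
        (simp add: add_divide_distrib e_add ring_distribs mult_ac)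
    finally show ?thesis .
  qed
  have "(\<Sum>l<L. (real R)\<^sup>2 * norm (\<Sum>n<N. a n * g (l + p n)) ^ 2)
      = (\<Sum>l<L. norm (of_nat R * (\<Sum>n<N. a n * g (l + p n))) ^ 2)"
    by (simp add: norm_mult power_mult_distrib)
  also have "\<dots> = (\<Sum>l<L. norm (\<Sum>j<R. (G j * m j) * ?E j l) ^ 2)"
    by (intro sum.cong refl) (simp add: conv)
  also have "\<dots> \<le> (\<Sum>l<R. norm (\<Sum>j<R. (G j * m j) * ?E j l) ^ 2)"
    using \<open>L \<le> R\<close> by (intro sum_mono2) auto
  also have "\<dots> = real R * (\<Sum>j<R. norm (G j * m j) ^ 2)"
    by (rule parseval_dft[OF \<open>R > 0\<close>])
  also have "\<dots> \<le> real R * (\<Sum>j<R. \<Lambda>\<^sup>2 * norm (G j) ^ 2)"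
  proof -
    have "norm (m j) \<le> \<Lambda>" for j
      using bound[of "real j / real R"] by (simp add: m_def)
    then have "norm (m j) ^ 2 \<le> \<Lambda>\<^sup>2" for j by (simp add: power_mono)
    then show ?thesis
      by (intro mult_left_mono sum_mono)
        (simp_all add: norm_mult power_mult_distrib mult.commute[of "norm (G _) ^ 2"] mult_right_mono)
  qed
  also have "(\<Sum>j<R. \<Lambda>\<^sup>2 * norm (G j) ^ 2) = \<Lambda>\<^sup>2 * (\<Sum>j<R. norm (\<Sum>m<R. cnj (g m) * ?E m j) ^ 2)"
  proof -
    have "norm (G j) = norm (\<Sum>m<R. cnj (g m) * ?E m j)" for j
    proof -
      have "cnj (G j) = (\<Sum>m<R. cnj (g m) * ?E m j)" by (simp add: G_def)
      then show ?thesis by (metis complex_mod_cnj)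
    qed
    then show ?thesis by (simp add: sum_distrib_left)
  qed
  also have "\<dots> = \<Lambda>\<^sup>2 * (real R * (\<Sum>l<R. norm (g l) ^ 2))"
    by (subst parseval_dft[OF \<open>R > 0\<close>]) simp
  finally have "(real R)\<^sup>2 * (\<Sum>l<L. norm (\<Sum>n<N. a n * g (l + p n)) ^ 2)
      \<le> (real R)\<^sup>2 * (\<Lambda>\<^sup>2 * (\<Sum>l<R. norm (g l) ^ 2))"
    by (simp add: sum_distrib_left power2_eq_square mult_ac)
  then show ?thesis using \<open>R > 0\<close> by simp
qed

subsection \<open>Lower bounds for products of exponential sums\<close>

lemma sum_lessThan_mult_split:
  fixes F :: "nat \<Rightarrow> 'b::comm_monoid_add"
  shows "(\<Sum>n<N * N'. F n) = (\<Sum>b<N'. \<Sum>a<N. F (a + N * b))"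
proof (induction N')
  case (Suc N')
  have "{..<N * Suc N'} = {..<N * N'} \<union> {N * N'..<N * N' + N}" by auto
  then have "(\<Sum>n<N * Suc N'. F n) = (\<Sum>n<N * N'. F n) + (\<Sum>n\<in>{N * N'..<N * N' + N}. F n)"
    using sum.union_disjoint[of "{..<N * N'}" "{N * N'..<N * N' + N}" F] by fastforce
  also have "(\<Sum>n\<in>{N * N'..<N * N' + N}. F n) = (\<Sum>a<N. F (a + N * N'))"
    using sum.shift_bounds_nat_ivl[of F 0 "N * N'" N] by (simp add: atLeast0LessThan add.commute)
  finally show ?case using Suc by simp
qed simp

section \<open>Elementary properties of q-multiplicative functions\<close>

lemma q_multiplicativeD:
  "q_multiplicative q f \<Longrightarrow> m < q ^ t \<Longrightarrow> f (m + q ^ t * n) = f m * f (q ^ t * n)"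
  unfolding q_multiplicative_def using dvd_triv_left by blast

lemma q_multiplicative_0:
  assumes "q_multiplicative q f" "norm (f 0) = 1" shows "f 0 = 1"
proof -
  have "f 0 = f 0 * f 0" using q_multiplicativeD[OF assms(1), of 0 0 0] by simp
  then show ?thesis using assms(2) by auto
qed

lemma q_multiplicative_power:
  "q_multiplicative q f \<Longrightarrow> q_multiplicative (q ^ w) f"
  by (simp add: q_multiplicative_def flip: power_mult)

lemma q_multiplicative_shift:
  assumes "q_multiplicative q f" "q > 0"
  shows "q_multiplicative q (\<lambda>n. f (q ^ i * n))"
  unfolding q_multiplicative_def
proof (intro allI impI)
  fix t m n assume *: "m < q ^ t \<and> q ^ t dvd n"
  then have "q ^ i * m < q ^ (i + t)" "q ^ (i + t) dvd q ^ i * n"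
    using assms(2) by (auto simp: power_add)
  then show "f (q ^ i * (m + n)) = f (q ^ i * m) * f (q ^ i * n)"
    using assms(1) unfolding q_multiplicative_def by (simp add: distrib_left)
qed

text \<open>Every frequency \<open>x\<close> on the circle has a preimage \<open>y\<close> under multiplication by \<open>N\<close> at which the
  normalised exponential sum of \<open>g\<close> has size at least \<open>\<kappa>\<close>. Unlike a lower bound for the supremum over
  all frequencies, this property is stable under concatenation of digit blocks.\<close>

definition lifts_frequencies :: "(nat \<Rightarrow> complex) \<Rightarrow> nat \<Rightarrow> real \<Rightarrow> bool" where
  "lifts_frequencies g N \<kappa> \<longleftrightarrow>
     (\<forall>x. \<exists>y. real N * y - x \<in> \<int> \<and> \<kappa> * real N \<le> norm (\<Sum>n<N. g n * e (real n * y)))"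

text \<open>First lift \<open>x\<close> through the upper block to \<open>y'\<close>, then
  \<open>y'\<close> through the lower block to \<open>y\<close>. As \<open>real N * y\<close> and
  \<open>y'\<close> agree modulo 1, the sum at \<open>y\<close> factors exactly into the two block
  sums.\<close>

lemma lifts_frequencies_mult:
  assumes "lifts_frequencies g N \<kappa>" "lifts_frequencies (\<lambda>n. g (N * n)) N' \<kappa>'"
    and mult: "\<And>a b. a < N \<Longrightarrow> b < N' \<Longrightarrow> g (a + N * b) = g a * g (N * b)"
    and "\<kappa> \<ge> 0" "\<kappa>' \<ge> 0"
  shows "lifts_frequencies g (N * N') (\<kappa> * \<kappa>')"
  unfolding lifts_frequencies_def
proof
  fix x
  obtain y' where y': "real N' * y' - x \<in> \<int>"
    "\<kappa>' * real N' \<le> norm (\<Sum>n<N'. g (N * n) * e (real n * y'))"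
    using assms(2) unfolding lifts_frequencies_def by blast
  obtain y where y: "real N * y - y' \<in> \<int>"
    "\<kappa> * real N \<le> norm (\<Sum>n<N. g n * e (real n * y))"
    using assms(1) unfolding lifts_frequencies_def by blast
  have e: "e (real (a + N * b) * y) = e (real a * y) * e (real b * y')" for a b
  proof -
    have "real (a + N * b) * y = real a * y + real b * y' + real b * (real N * y - y')"
      by (simp add: algebra_simps)
    moreover have "e (real b * (real N * y - y')) = 1"
      using y(1) by (intro e_Ints Ints_mult) auto
    ultimately show ?thesis by (simp add: e_add)
  qed
  have "(\<Sum>n<N * N'. g n * e (real n * y))
      = (\<Sum>b<N'. \<Sum>a<N. (g (N * b) * e (real b * y')) * (g a * e (real a * y)))"
    unfolding sum_lessThan_mult_split by (intro sum.cong refl) (simp add: e mult del: of_nat_add of_nat_mult)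
  also have "\<dots> = (\<Sum>b<N'. g (N * b) * e (real b * y')) * (\<Sum>a<N. g a * e (real a * y))"
    by (simp add: sum_product)
  finally have "norm (\<Sum>n<N * N'. g n * e (real n * y))
      \<ge> (\<kappa>' * real N') * (\<kappa> * real N)"
    using y(2) y'(2) assms(4,5) by (simp only: norm_mult) (intro mult_mono; simp)
  then have "\<kappa> * \<kappa>' * real (N * N') \<le> norm (\<Sum>n<N * N'. g n * e (real n * y))"
    by (simp add: mult_ac)
  moreover have eq: "real (N * N') * y - x = real N' * (real N * y - y') + (real N' * y' - x)"
    by (simp add: algebra_simps)
  have "real (N * N') * y - x \<in> \<int>"
    unfolding eq using y(1) y'(1) by (intro Ints_add Ints_mult) auto
  ultimately show "\<exists>y. real (N * N') * y - x \<in> \<int> \<and>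
      \<kappa> * \<kappa>' * real (N * N') \<le> norm (\<Sum>n<N * N'. g n * e (real n * y))"
    by blast
qed

text \<open>By Parseval the squared sums at the \<open>N\<close> preimages (x + j)/N of
  \<open>x\<close> add up to N^2, so at one of them the sum has size at least sqrt N.\<close>

lemma lifts_frequencies_parseval:
  assumes "N > 0" "\<And>n. norm (g n) = 1"
  shows "lifts_frequencies g N (1 / sqrt (real N))"
  unfolding lifts_frequencies_def
proof
  fix x
  define S where "S j = (\<Sum>l<N. (g l * e (real l * x / real N)) * e (real l * real j / real N))" for j
  have tot: "(\<Sum>j<N. norm (S j) ^ 2) = real N * real N"
    unfolding S_def using assms by (subst parseval_dft) (simp_all add: norm_mult)
  have "\<exists>j<N. real N \<le> norm (S j) ^ 2"
  proof (rule ccontr)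
    assume "\<not> ?thesis"
    then have "(\<Sum>j<N. norm (S j) ^ 2) < (\<Sum>j<N. real N)"
      using assms(1) by (intro sum_strict_mono) auto
    then show False using tot by simp
  qed
  then obtain j where j: "real N \<le> norm (S j) ^ 2" by blast
  define y where "y = (x + real j) / real N"
  have "S j = (\<Sum>n<N. g n * e (real n * y))"
    unfolding S_def y_def
    by (intro sum.cong refl) (simp add: mult.assoc e_add[symmetric] ring_distribs add_divide_distrib)
  moreover have "1 / sqrt (real N) * real N \<le> norm (S j)"
    using j assms(1) by (simp add: real_div_sqrt real_le_lsqrt)
  moreover have "real N * y - x \<in> \<int>" using assms(1) by (simp add: y_def)
  ultimately show "\<exists>y. real N * y - x \<in> \<int> \<and> 1 / sqrt (real N) * real N
      \<le> norm (\<Sum>n<N. g n * e (real n * y))" by auto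
qed

section \<open>Geometric sums at small frequencies\<close>

lemma sum_centred_squares:
  "(\<Sum>n<N. (2 * real n - (real N - 1))\<^sup>2) = real N * ((real N)\<^sup>2 - 1) / 3"
proof -
  have "(\<Sum>n<M. (2 * real n - a)\<^sup>2)
      = 2 * (real M - 1) * real M * (2 * real M - 1) / 3 - 2 * a * (real M - 1) * real M + a\<^sup>2 * real M"
    for a :: real and M :: nat
    by (induction M) (simp_all add: field_simps power2_eq_square)
  from this[of "real N - 1" N] show ?thesis
    by (simp add: field_simps power2_eq_square)
qed

lemma cos_ge_quadratic: "cos x \<ge> 1 - x\<^sup>2 / 2" for x :: real
proof -
  have "(sin (x / 2))\<^sup>2 \<le> (x / 2)\<^sup>2"
    using abs_sin_x_le_abs_x[of "x / 2"] unfolding abs_le_square_iff .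
  then show ?thesis using cos_double_sin[of "x / 2"] by (simp add: power_divide)
qed

text \<open>A factor of modulus one centres the exponents about 0, so that passing to real parts
  loses only a second-order amount. The quadratic bound for the cosine costs at most a fraction
  pi^2/24 of \<open>N\<close>, which is at most 1/2.\<close>

lemma norm_geometric_e_ge:
  assumes "real N * \<bar>\<theta>\<bar> \<le> 1 / 2"
  shows "norm (\<Sum>n<N. e (real n * \<theta>)) \<ge> real N / 2"
proof -
  let ?d = "\<lambda>n. 2 * real n - (real N - 1)"
  have "real N - 2 * pi\<^sup>2 * \<theta>\<^sup>2 / 4 * (real N * ((real N)\<^sup>2 - 1) / 3)
      = (\<Sum>n<N. 1 - (2 * pi * (?d n * \<theta> / 2))\<^sup>2 / 2)"
    unfolding sum_centred_squares[symmetric]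
    unfolding sum_subtractf sum_distrib_left
    by (intro arg_cong2[where f=minus] sum.cong) (simp_all add: power_mult_distrib power_divide)
  also have "\<dots> \<le> (\<Sum>n<N. cos (2 * pi * (?d n * \<theta> / 2)))"
    by (intro sum_mono cos_ge_quadratic)
  also have "\<dots> = Re (\<Sum>n<N. e (?d n * \<theta> / 2))"
    by (simp add: e_eq_cis)
  also have "\<dots> \<le> norm (\<Sum>n<N. e (?d n * \<theta> / 2))" by (rule complex_Re_le_cmod)
  also have "(\<Sum>n<N. e (?d n * \<theta> / 2)) = e (- (real N - 1) * \<theta> / 2) * (\<Sum>n<N. e (real n * \<theta>))"
    unfolding sum_distrib_left e_add[symmetric] by (intro sum.cong refl arg_cong[where f=e]) (simp add: field_simps)
  also have "norm \<dots> = norm (\<Sum>n<N. e (real n * \<theta>))" by (simp add: norm_mult)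
  finally have 1: "real N - 2 * pi\<^sup>2 * \<theta>\<^sup>2 / 4 * (real N * ((real N)\<^sup>2 - 1) / 3)
      \<le> norm (\<Sum>n<N. e (real n * \<theta>))" .
  have "(real N * \<bar>\<theta>\<bar>)\<^sup>2 \<le> (1 / 2)\<^sup>2" using assms by (intro power_mono) auto
  then have "\<theta>\<^sup>2 * (real N)\<^sup>2 \<le> 1 / 4" by (simp add: power_mult_distrib power_divide mult_ac)
  then have t: "\<theta>\<^sup>2 * ((real N)\<^sup>2 - 1) \<le> 1 / 4" using zero_le_power2[of \<theta>] unfolding right_diff_distrib by linarith
  have "pi \<le> 3.2" using pi_approx by simp
  then have "pi\<^sup>2 \<le> 3.2\<^sup>2" by (intro power_mono) auto
  then have p: "pi\<^sup>2 \<le> 12" by (simp add: power2_eq_square)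
  have "pi\<^sup>2 * (\<theta>\<^sup>2 * ((real N)\<^sup>2 - 1)) \<le> pi\<^sup>2 * (1/4)" using t by (intro mult_left_mono) auto
  also have "\<dots> \<le> 3" using p by simp
  finally have "real N * (pi\<^sup>2 * (\<theta>\<^sup>2 * ((real N)\<^sup>2 - 1))) \<le> real N * 3" by (intro mult_left_mono) auto
  then have "2 * pi\<^sup>2 * \<theta>\<^sup>2 / 4 * (real N * ((real N)\<^sup>2 - 1) / 3) \<le> real N / 2"
    by (simp add: mult_ac)
  then show ?thesis using 1 by linarith
qed

text \<open>The preimages of \<open>x\<close> are spaced by 1/N, so one of them nearly cancels the
  slope \<open>\<alpha>\<close>. There the geometric sum is at least N/2, and replacing
  \<open>g\<close> by the linear phase costs at most N/4.\<close>

lemma lifts_frequencies_near_linear: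
  assumes "\<And>n. n < N \<Longrightarrow> norm (g n - e (real n * \<alpha>)) \<le> 1 / 4" "N > 0"
  shows "lifts_frequencies g N (1 / 4)"
  unfolding lifts_frequencies_def
proof
  fix x
  \<comment> \<open>Rounding selects the preimage closest to \<open>- \<alpha>\<close>, at distance
    at most 1/(2N).\<close>
  define j where "j = round (- \<alpha> * real N - x)"
  define y where "y = (x + of_int j) / real N"
  have Ny: "real N * y = x + of_int j" using assms(2) by (simp add: y_def)
  have "real N * (y + \<alpha>) = of_int j - (- \<alpha> * real N - x)"
    using Ny by (simp add: ring_distribs)
  then have "\<bar>real N * (y + \<alpha>)\<bar> \<le> 1 / 2"
    using of_int_round_abs_le[of "- \<alpha> * real N - x", folded j_def] by simp
  then have "norm (\<Sum>n<N. e (real n * (y + \<alpha>))) \<ge> real N / 2"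
    by (intro norm_geometric_e_ge) (simp add: abs_mult)
  moreover have "norm ((\<Sum>n<N. g n * e (real n * y)) - (\<Sum>n<N. e (real n * (y + \<alpha>)))) \<le> (\<Sum>n<N. 1 / 4)"
    unfolding sum_subtractf[symmetric]
  proof (intro order.trans[OF norm_sum] sum_mono)
    fix n assume "n \<in> {..<N}"
    have "g n * e (real n * y) - e (real n * (y + \<alpha>)) = (g n - e (real n * \<alpha>)) * e (real n * y)"
      by (simp add: ring_distribs e_add)
    then show "norm (g n * e (real n * y) - e (real n * (y + \<alpha>))) \<le> 1 / 4"
      using assms(1)[of n] \<open>n \<in> _\<close> by (simp add: norm_mult)
  qed
  ultimately have "1 / 4 * real N \<le> norm (\<Sum>n<N. g n * e (real n * y))"
    using norm_triangle_ineq2[of "\<Sum>n<N. e (real n * (y + \<alpha>))" "\<Sum>n<N. g n * e (real n * y)"]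
    by (simp add: norm_minus_commute)
  then show "\<exists>y. real N * y - x \<in> \<int> \<and> 1 / 4 * real N \<le> norm (\<Sum>n<N. g n * e (real n * y))"
    using Ny by (intro exI[of _ y]) auto
qed

lemma lifts_frequencies_prod:
  assumes "q_multiplicative q f" "f 0 = 1"
    and "\<And>i. i < L \<Longrightarrow> lifts_frequencies (\<lambda>n. f (q ^ i * n)) q (\<kappa> i)"
    and "\<And>i. \<kappa> i \<ge> 0"
  shows "lifts_frequencies f (q ^ L) (\<Prod>i<L. \<kappa> i)"
  using assms(3)
proof (induction L)
  case 0
  have "\<exists>y. y - x \<in> \<int>" for x :: real by (rule exI[of _ x]) simp
  then show ?case using assms(2) by (simp add: lifts_frequencies_def)
next
  case (Suc L)
  have "lifts_frequencies f (q ^ L * q) ((\<Prod>i<L. \<kappa> i) * \<kappa> L)"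
    using Suc assms by (intro lifts_frequencies_mult q_multiplicativeD prod_nonneg) auto
  then show ?case by (simp add: mult_ac)
qed

text \<open>Concatenating all blocks gives a frequency at which the normalised sum over
  \<open>q ^ L\<close> terms is at least the product of the block bounds, while the Gelfond bound
  forces it below C q^(-cL). Good blocks account for at most half of this exponent, and a bad block
  only for a factor q^(-1/2) by Parseval. Hence at least c L - O(1) of the first \<open>L\<close>
  blocks are bad.\<close>

lemma gelfond_obstruction_count:
  assumes "q_multiplicative q f" "q \<ge> 2" "f 0 = 1" "\<And>n. norm (f n) = 1"
    and gelfond: "\<And>N \<alpha>. N \<ge> 1 \<Longrightarrow>
      norm ((1 / of_nat N) * (\<Sum>n<N. f n * e (real n * \<alpha>))) \<le> C * real N powr (- c)"
    and good: "\<And>i. \<not> bad i \<Longrightarrow> lifts_frequencies (\<lambda>n. f (q ^ i * n)) q \<kappa>"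
    and \<kappa>: "\<kappa> \<ge> real q powr (- c / 2)" "\<kappa> \<le> 1"
  shows "real q powr (c * real L) \<le> C\<^sup>2 * real q ^ card {i\<in>{..<L}. bad i}"
proof -
  define b where "b = card {i\<in>{..<L}. bad i}"
  define k where "k i = (if bad i then 1 / sqrt (real q) else \<kappa>)" for i
  have \<kappa>0: "\<kappa> > 0" using \<kappa>(1) assms(2) by (intro less_le_trans[OF _ \<kappa>(1)]) simp
  have "lifts_frequencies (\<lambda>n. f (q ^ i * n)) q (k i)" for i
    using good lifts_frequencies_parseval[of q "\<lambda>n. f (q ^ i * n)"] assms(2,4) by (auto simp: k_def)
  then have "lifts_frequencies f (q ^ L) (\<Prod>i<L. k i)"
    using assms \<kappa>0 by (intro lifts_frequencies_prod) (auto simp: k_def)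
  then obtain y where "(\<Prod>i<L. k i) * real (q ^ L) \<le> norm (\<Sum>n<q ^ L. f n * e (real n * y))"
    unfolding lifts_frequencies_def by blast
  moreover have "norm (\<Sum>n<q ^ L. f n * e (real n * y)) \<le> C * real (q ^ L) powr (- c) * real (q ^ L)"
  proof -
    have "q ^ L \<ge> 1" using assms(2) by simp
    then have "norm (\<Sum>n<q ^ L. f n * e (real n * y)) / real (q ^ L) \<le> C * real (q ^ L) powr (- c)"
      using gelfond[of "q ^ L" y] by (simp add: norm_divide norm_power)
    then show ?thesis using assms(2) by (subst (asm) pos_divide_le_eq) simp_all
  qed
  ultimately have up: "(\<Prod>i<L. k i) \<le> C * real (q ^ L) powr (- c)"
    using assms(2) mult_le_cancel_right_pos[of "real (q ^ L)"] by (meson of_nat_0_less_iff order.trans pos2 zero_less_power less_le_trans)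
  let ?Q = "real q"
  have Q: "?Q \<ge> 2" using assms(2) by simp
  have "?Q powr (- (c * real L) / 2) * ?Q powr (- real b / 2) = (?Q powr (- c / 2)) ^ L * (?Q powr (- 1 / 2)) ^ b"
    using Q by (simp add: powr_power mult.commute)
  also have "\<dots> \<le> \<kappa> ^ L * (?Q powr (- 1 / 2)) ^ b"
    using \<kappa> by (intro mult_right_mono power_mono) auto
  also have "\<dots> \<le> (\<Prod>i<L. k i)"
  proof -
    have "?Q powr (- 1 / 2) = 1 / sqrt ?Q"
      using Q powr_minus[of ?Q "1 / 2"] by (simp add: powr_half_sqrt inverse_eq_divide)
    then have "(?Q powr (- 1 / 2)) ^ b = (\<Prod>i<L. if bad i then 1 / sqrt ?Q else 1)"
      by (simp add: b_def prod.If_cases Collect_conj_eq lessThan_def)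
    then have "\<kappa> ^ L * (?Q powr (- 1 / 2)) ^ b = (\<Prod>i<L. \<kappa> * (if bad i then 1 / sqrt ?Q else 1))"
      by (simp add: prod.distrib)
    also have "\<dots> \<le> (\<Prod>i<L. k i)"
      using \<kappa>0 \<kappa>(2) Q by (intro prod_mono) (auto simp: k_def intro: mult_left_le_one_le divide_right_mono)
    finally show ?thesis .
  qed
  also note up
  also have "real (q ^ L) powr (- c) = ?Q powr (- (c * real L))"
    using Q by (simp add: powr_realpow[symmetric] powr_powr mult_ac)
  finally have le: "?Q powr (- (c * real L) / 2) * ?Q powr (- real b / 2) \<le> C * ?Q powr (- (c * real L))" .
  \<comment> \<open>Clearing the decaying factors leaves Q^(cL/2) at most C Q^(b/2), where
    \<open>b\<close> counts the bad blocks; squaring then removes the halves.\<close>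
  have "?Q powr (c * real L / 2) = ?Q powr (c * real L) * ?Q powr (real b / 2) *
      (?Q powr (- (c * real L) / 2) * ?Q powr (- real b / 2))"
    by (simp only: powr_add[symmetric]) simp
  also have "\<dots> \<le> ?Q powr (c * real L) * ?Q powr (real b / 2) * (C * ?Q powr (- (c * real L)))"
    using le by (intro mult_left_mono) auto
  also have "\<dots> = C * ?Q powr (real b / 2) * (?Q powr (c * real L) * ?Q powr (- (c * real L)))"
    by (simp only: mult_ac)
  also have "?Q powr (c * real L) * ?Q powr (- (c * real L)) = 1"
    using Q by (simp only: powr_add[symmetric]) simp
  finally have "(?Q powr (c * real L / 2))\<^sup>2 \<le> (C * ?Q powr (real b / 2))\<^sup>2"
    by (intro power_mono) auto
  moreover have "(?Q powr (t / 2))\<^sup>2 = ?Q powr t" for t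
    by (simp add: power2_eq_square powr_add[symmetric])
  ultimately show ?thesis using Q
    unfolding b_def[symmetric] by (simp add: power_mult_distrib powr_realpow)
qed

subsection \<open>Cube products and near-polynomial phases\<close>

text \<open>For a constant family this is the iterated multiplicative derivative along
  \<open>hs\<close>, a vertex being conjugated once for each \<open>False\<close> in its label.
  Vertex-dependent functions are allowed because carries will shift the vertices
  differently.\<close>

fun cube :: "'b::ab_semigroup_add list \<Rightarrow> (bool list \<Rightarrow> 'b \<Rightarrow> complex) \<Rightarrow> 'b \<Rightarrow> complex" where
  "cube [] G n = G [] n"
| "cube (h # hs) G n = cube hs (\<lambda>\<omega>. G (True # \<omega>)) (n + h) * cnj (cube hs (\<lambda>\<omega>. G (False # \<omega>)) n)"

lemma norm_cube_eq_1: "(\<And>\<omega> m. norm (G \<omega> m) = 1) \<Longrightarrow> norm (cube hs G n) = 1"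
  by (induction hs arbitrary: G n) (simp_all add: norm_mult)

lemma norm_cube_le_1: "(\<And>\<omega> m. norm (G \<omega> m) \<le> 1) \<Longrightarrow> norm (cube hs G n) \<le> 1"
  by (induction hs arbitrary: G n) (simp_all add: norm_mult mult_le_one)

lemma cube_mult: "cube hs (\<lambda>\<omega> m. A \<omega> m * B \<omega> m) n = cube hs A n * cube hs B n"
  by (induction hs arbitrary: A B n) (simp_all add: mult_ac)

lemma cube_cnj: "cube hs (\<lambda>\<omega> m. cnj (A \<omega> m)) n = cnj (cube hs A n)"
  by (induction hs arbitrary: A n) simp_all

lemma cube_translate: "cube hs (\<lambda>\<omega> m. G \<omega> (m + a)) n = cube hs G (n + a)"
proof (induction hs arbitrary: G n)
  case (Cons h hs)
  show ?case
    using Cons.IH[of "\<lambda>\<omega>. G (True # \<omega>)" "n + h"] Cons.IH[of "\<lambda>\<omega>. G (False # \<omega>)" n]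
    by (simp add: add.assoc add.commute[of a])
qed simp

text \<open>The cube without its first side has a value of modulus one that does not depend on the
  base point, so the first difference cancels it.\<close>

lemma cube_const:
  assumes "hs \<noteq> []" "norm c = 1" shows "cube hs (\<lambda>_ _. c) n = 1"
proof -
  have "norm (cube hs (\<lambda>_ _. c) n) = 1" for hs and n :: 'a
    using assms(2) by (intro norm_cube_eq_1)
  moreover have "cube hs (\<lambda>_ _. c) n = cube hs (\<lambda>_ _. c) n'" for hs and n n' :: 'a
  proof (induction hs arbitrary: n n')
    case (Cons h hs)
    show ?case using Cons.IH[of "n + h" "n' + h"] Cons.IH[of n n'] by simp
  qed simp
  moreover obtain h hs' where hs: "hs = h # hs'" using assms(1) by (cases hs) auto
  ultimately have "cube hs' (\<lambda>_ _. c) (n + h) = cube hs' (\<lambda>_ _. c) n" "norm (cube hs' (\<lambda>_ _. c) n) = 1"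
    by blast+
  then show ?thesis unfolding hs cube.simps by (simp only: cnj_mult_unimodular)
qed

lemma cube_affine:
  fixes hs :: "nat list"
  shows "cube (map ((*) q) hs) (\<lambda>_. u) (c + q * n) = cube hs (\<lambda>_ y. u (c + q * y)) n"
proof (induction hs arbitrary: n)
  case (Cons h hs)
  have "c + q * n + q * h = c + q * (n + h)" by (simp add: distrib_left)
  then show ?case by (simp only: list.map cube.simps Cons.IH)
qed simp

lemma norm_mult_cnj_diff:
  assumes "norm w = 1" shows "norm (z * cnj w - 1) = norm (z - w)"
proof -
  have "z * cnj w - 1 = (z - w) * cnj w"
    using cnj_mult_unimodular[OF assms] by (simp add: left_diff_distrib)
  then show ?thesis using assms by (simp add: norm_mult)
qed

text \<open>\<open>near_polynomial W k \<delta> u\<close>: on \<open>{0..<W}\<close> the function \<open>u\<close> is, up to \<open>\<delta>\<close>, a polynomial phase of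
  degree less than \<open>k\<close>.\<close>

definition near_polynomial :: "nat \<Rightarrow> nat \<Rightarrow> real \<Rightarrow> (nat \<Rightarrow> complex) \<Rightarrow> bool" where
  "near_polynomial W k \<delta> u \<longleftrightarrow>
     (\<forall>hs n. length hs = k \<longrightarrow> n + sum_list hs < W \<longrightarrow> norm (cube hs (\<lambda>_. u) n - 1) \<le> \<delta>)"

lemma near_polynomialD:
  "near_polynomial W k \<delta> u \<Longrightarrow> length hs = k \<Longrightarrow> n + sum_list hs < W \<Longrightarrow> norm (cube hs (\<lambda>_. u) n - 1) \<le> \<delta>"
  by (simp add: near_polynomial_def)

lemma near_polynomial_mono:
  "near_polynomial W k \<delta> u \<Longrightarrow> \<delta> \<le> \<delta>' \<Longrightarrow> near_polynomial W k \<delta>' u"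
  unfolding near_polynomial_def using order_trans by blast

text \<open>Restricting a \<open>q\<close>-multiplicative function to multiples of \<open>q\<close> lowers the degree: a difference with
  step \<open>q h\<close> is a sum of differences with step \<open>1\<close>, and by multiplicativity
  \<open>\<partial>\<^sub>1 u\<close> is constant on multiples of \<open>q\<close>.\<close>

lemma near_polynomial_degree_reduction:
  assumes mult: "q_multiplicative q u" and uni: "\<And>n. norm (u n) = 1" and "q \<ge> 2" "D \<ge> 2" "\<delta> \<ge> 0"
    and np: "near_polynomial (q * W) (Suc D) \<delta> u"
  shows "near_polynomial W D ((real (q * W))\<^sup>2 * \<delta>) (\<lambda>y. u (q * y))"
  unfolding near_polynomial_def
proof (intro allI impI)
  fix hs n assume len: "length hs = D" and range: "n + sum_list hs < W"
  obtain h hs' where hs: "hs = h # hs'" "length hs' = D - 1" "hs' \<noteq> []"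
    using len \<open>D \<ge> 2\<close> by (cases hs; cases "tl hs") auto
  define as where "as = map ((*) q) hs'"
  define V where "V = cube as (\<lambda>_. u)"
  define dV where "dV m = V (m + 1) * cnj (V m)" for m
  have V1: "norm (V m) = 1" for m unfolding V_def using uni by (rule norm_cube_eq_1)
  then have dV1: "norm (dV m) = 1" for m by (simp add: dV_def norm_mult)
  \<comment> \<open>As 1 < q, multiplicativity splits off the constant \<open>u 1\<close>, and
    \<open>cube_const\<close> removes it because \<open>hs'\<close> is nonempty. So the unit
    difference \<open>dV\<close> is exactly 1 at 0.\<close>
  have "V (1 + q * 0) = cube hs' (\<lambda>_ y. u 1 * u (0 + q * y)) 0"
    unfolding V_def as_def cube_affine using q_multiplicativeD[OF mult, of 1 1] \<open>q \<ge> 2\<close> by simp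
  also have "\<dots> = cube hs' (\<lambda>_ _. u 1) 0 * V (0 + q * 0)"
    unfolding cube_mult V_def as_def cube_affine ..
  also have "\<dots> = V 0" using cube_const[OF hs(3) uni, of 1 "0::nat"] by simp
  finally have dV0: "dV 0 = 1" using V1 by (simp add: dV_def cnj_mult_unimodular)
  \<comment> \<open>Two unit steps on top of the D - 1 steps in \<open>as\<close> make D + 1
    differences, so the hypothesis controls the change of \<open>dV\<close>.\<close>
  have step: "norm (dV (m + 1) - dV m) \<le> \<delta>" if "m + 2 + sum_list as < q * W" for m
  proof -
    have "norm (cube (1 # 1 # as) (\<lambda>_. u) m - 1) \<le> \<delta>"
      using that hs(2) \<open>D \<ge> 2\<close> by (intro near_polynomialD[OF np]) (simp_all add: as_def)
    then have "norm (dV (m + 1) * cnj (dV m) - 1) \<le> \<delta>"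
      by (simp add: dV_def V_def)
    then show ?thesis by (simp add: norm_mult_cnj_diff dV1)
  qed
  have dVm: "norm (dV m - 1) \<le> real m * \<delta>" if "m + 1 + sum_list as < q * W" for m
    using that
  proof (induction m)
    case (Suc m)
    have "norm (dV (Suc m) - 1) \<le> norm (dV (m + 1) - dV m) + norm (dV m - 1)"
      using norm_triangle_ineq[of "dV (m + 1) - dV m" "dV m - 1"] by simp
    then show ?case using Suc step[of m] by (simp add: algebra_simps)
  qed (simp add: dV0)
  \<comment> \<open>The step \<open>q * h\<close> will be telescoped into unit steps, whose values
    \<open>dV\<close> are within \<open>real (q * W) * \<delta>\<close> of 1; a second factor
    \<open>q * W\<close> bounds their number.\<close>
  have Vma: "norm (V (m + a) - V m) \<le> real a * (real (q * W) * \<delta>)" if "m + a + sum_list as < q * W" for m a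
    using that
  proof (induction a)
    case (Suc a)
    have "norm (V (m + Suc a) - V m) \<le> norm (V (m + a + 1) - V (m + a)) + norm (V (m + a) - V m)"
      using norm_triangle_ineq[of "V (m + a + 1) - V (m + a)" "V (m + a) - V m"] by simp
    also have "norm (V (m + a + 1) - V (m + a)) = norm (dV (m + a) - 1)"
      by (simp add: dV_def norm_mult_cnj_diff V1)
    also have "\<dots> \<le> real (m + a) * \<delta>" using Suc.prems by (intro dVm) simp
    also have "\<dots> \<le> real (q * W) * \<delta>" using Suc.prems \<open>\<delta> \<ge> 0\<close> by (intro mult_right_mono) linarith+
    finally show ?case using Suc by (simp add: algebra_simps)
  qed simp
  have "cube hs (\<lambda>_ y. u (0 + q * y)) n = V (q * n + q * h) * cnj (V (q * n))"
    unfolding V_def cube_affine[symmetric] as_def hs(1) by simp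
  then have "norm (cube hs (\<lambda>_ y. u (q * y)) n - 1) = norm (V (q * n + q * h) - V (q * n))"
    by (simp add: norm_mult_cnj_diff V1)
  also have "\<dots> \<le> real (q * h) * (real (q * W) * \<delta>)"
  proof (rule Vma)
    have "q * (n + h + sum_list hs') < q * W" using range \<open>q \<ge> 2\<close> by (simp add: hs(1))
    then show "q * n + q * h + sum_list as < q * W"
      by (simp add: as_def sum_list_const_mult distrib_left)
  qed
  also have "\<dots> \<le> real (q * W) * (real (q * W) * \<delta>)"
    using range \<open>\<delta> \<ge> 0\<close> by (intro mult_right_mono) (auto simp: hs(1) intro!: mult_left_mono)
  finally show "norm (cube hs (\<lambda>_ y. u (q * y)) n - 1) \<le> (real (q * W))\<^sup>2 * \<delta>"
    by (simp add: power2_eq_square mult_ac)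
qed

text \<open>Each degree reduction trades one base-\<open>q\<close> digit of the window for one
  degree, so \<open>s\<close> of them lead from \<open>s + 2\<close> differences to 2. Each
  multiplies the error by the square of the current window length, bounded here by the initial
  length.\<close>

lemma near_polynomial_imp_near_linear_step:
  assumes "q_multiplicative q u" and "\<And>n. norm (u n) = 1" and "q \<ge> 2" "\<delta> \<ge> 0"
    and "near_polynomial (q ^ (w + s)) (s + 2) \<delta> u"
  shows "near_polynomial (q ^ w) 2 (real (q ^ (w + s)) ^ (2 * s) * \<delta>) (\<lambda>y. u (q ^ s * y))"
  using assms
proof (induction s arbitrary: u \<delta>)
  case (Suc s)
  let ?u = "\<lambda>y. u (q * y)" and ?\<delta> = "(real (q * q ^ (w + s)))\<^sup>2 * \<delta>"
  have "near_polynomial (q ^ (w + s)) (s + 2) ?\<delta> ?u"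
    using Suc.prems by (intro near_polynomial_degree_reduction) auto
  moreover have "q_multiplicative q ?u"
    using q_multiplicative_shift[OF Suc.prems(1), of 1] Suc.prems(3) by simp
  ultimately have "near_polynomial (q ^ w) 2 (real (q ^ (w + s)) ^ (2 * s) * ?\<delta>) (\<lambda>y. ?u (q ^ s * y))"
    using Suc.prems by (intro Suc.IH) auto
  moreover have "real (q ^ (w + s)) ^ (2 * s) * ?\<delta> \<le> real (q ^ (w + Suc s)) ^ (2 * Suc s) * \<delta>"
  proof -
    have "real (q ^ (w + s)) \<le> real (q ^ (w + Suc s))" using Suc.prems(3) by simp
    then have "real (q ^ (w + s)) ^ (2 * s) * ?\<delta> \<le> real (q ^ (w + Suc s)) ^ (2 * s) * ?\<delta>"
      using Suc.prems(4) by (intro mult_right_mono power_mono) auto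
    also have "\<dots> = real (q ^ (w + Suc s)) ^ (2 * Suc s) * \<delta>"
      by (simp add: power2_eq_square)
    finally show ?thesis .
  qed
  ultimately show ?case by (auto simp: mult_ac intro: near_polynomial_mono)
qed (simp add: numeral_2_eq_2)

text \<open>A second difference at 0 with sides \<open>y\<close> and 1 compares
  \<open>u (y + 1)\<close> with \<open>u y * u 1\<close>; induction on \<open>y\<close> accumulates
  one error \<open>\<delta>\<close> per step.\<close>

lemma near_linear_character:
  assumes "near_polynomial W 2 \<delta> u" "u 0 = 1" "\<And>n. norm (u n) = 1" "y < W"
  shows "norm (u y - u 1 ^ y) \<le> real y * \<delta>"
  using assms(4)
proof (induction y)
  case (Suc y)
  have "norm (cube [y, 1] (\<lambda>_. u) 0 - 1) \<le> \<delta>"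
    using Suc.prems by (intro near_polynomialD[OF assms(1)]) auto
  then have "norm (u (y + 1) * cnj (u y * u 1) - 1) \<le> \<delta>" by (simp add: assms(2) mult_ac)
  then have "norm (u (y + 1) - u y * u 1) \<le> \<delta>"
    by (subst (asm) norm_mult_cnj_diff) (simp_all add: assms(3) norm_mult)
  moreover have "norm (u y * u 1 - u 1 ^ Suc y) = norm (u y - u 1 ^ y)"
  proof -
    have "u y * u 1 - u 1 ^ Suc y = (u y - u 1 ^ y) * u 1" by (simp add: left_diff_distrib)
    then show ?thesis by (simp only: norm_mult assms(3) mult_1_right)
  qed
  moreover have "norm (u (Suc y) - u 1 ^ Suc y) \<le> norm (u (y + 1) - u y * u 1) + norm (u y * u 1 - u 1 ^ Suc y)"
    using norm_triangle_ineq[of "u (y + 1) - u y * u 1" "u y * u 1 - u 1 ^ Suc y"] by simp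
  ultimately show ?case using Suc by (simp add: algebra_simps)
qed (simp add: assms(2))

text \<open>The lowest \<open>s\<close> digits are spent on reducing the degree and only get the
  Parseval bound; on the other \<open>w\<close> digits \<open>u\<close> is nearly linear. The
  resulting constant does not depend on \<open>w\<close>, which later allows \<open>w\<close> to be
  chosen large.\<close>

lemma near_polynomial_lifts_frequencies:
  assumes "q_multiplicative q u" and uni: "\<And>n. norm (u n) = 1" and "q \<ge> 2" "\<delta> \<ge> 0"
    and np: "near_polynomial (q ^ (w + s)) (s + 2) \<delta> u"
    and \<delta>: "real (q ^ (w + s)) ^ (2 * s + 1) * \<delta> \<le> 1 / 4"
  shows "lifts_frequencies u (q ^ (w + s)) (1 / sqrt (real (q ^ s)) * (1 / 4))"
proof -
  let ?v = "\<lambda>y. u (q ^ s * y)"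
  let ?d = "real (q ^ (w + s)) ^ (2 * s) * \<delta>"
  have u0: "u 0 = 1" using q_multiplicative_0[OF assms(1) uni] .
  have np2: "near_polynomial (q ^ w) 2 ?d ?v"
    using assms by (intro near_polynomial_imp_near_linear_step) auto
  obtain t where t: "?v 1 = e t" using unimodular_e[OF uni] by blast
  have "norm (?v n - e (real n * t)) \<le> 1 / 4" if "n < q ^ w" for n
  proof -
    have "norm (?v n - ?v 1 ^ n) \<le> real n * ?d"
      by (rule near_linear_character[OF np2]) (use that uni u0 in auto)
    also have "\<dots> \<le> real (q ^ (w + s)) * ?d"
    proof (intro mult_right_mono)
      have "q ^ w \<le> q ^ (w + s)" using assms(3) by (intro power_increasing) auto
      then show "real n \<le> real (q ^ (w + s))" using that by linarith
    qed (use \<open>\<delta> \<ge> 0\<close> in auto)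
    also have "\<dots> \<le> 1 / 4" using \<delta> by (simp add: mult_ac)
    finally show ?thesis by (simp only: t e_of_nat_mult)
  qed
  then have "lifts_frequencies ?v (q ^ w) (1 / 4)"
    using assms(3) by (intro lifts_frequencies_near_linear) auto
  moreover have "lifts_frequencies u (q ^ s) (1 / sqrt (real (q ^ s)))"
    using assms(3) uni by (intro lifts_frequencies_parseval) auto
  ultimately have "lifts_frequencies u (q ^ s * q ^ w) (1 / sqrt (real (q ^ s)) * (1 / 4))"
    by (intro lifts_frequencies_mult q_multiplicativeD[OF assms(1)]) auto
  then show ?thesis by (simp add: power_add mult.commute)
qed

subsection \<open>Van der Corput differencing\<close>

fun degree_at_most :: "nat \<Rightarrow> (int \<Rightarrow> real) \<Rightarrow> bool" where
  "degree_at_most 0 P \<longleftrightarrow> (\<forall>n. P n = P 0)"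
| "degree_at_most (Suc d) P \<longleftrightarrow> (\<forall>h. degree_at_most d (\<lambda>n. P (n + h) - P n))"

lemma degree_difference:
  fixes p :: "real poly"
  assumes "degree p \<le> Suc d"
  shows "degree (pcompose p [:h, 1:] - p) \<le> d"
proof (rule degree_le, intro allI impI)
  fix i assume "d < i"
  have deg: "degree (pcompose p [:h, 1:]) = degree p" by (simp add: degree_pcompose)
  show "coeff (pcompose p [:h, 1:] - p) i = 0"
  proof (cases "i = degree p")
    case True
    have "coeff (pcompose p [:h, 1:]) (degree p) = coeff p (degree p)"
      using lead_coeff_comp[of "[:h, 1:]" p] by (simp add: deg)
    then show ?thesis by (simp add: True)
  next
    case False
    then have "degree p < i" using assms \<open>d < i\<close> by linarith
    then show ?thesis using deg by (simp add: coeff_eq_0)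
  qed
qed

lemma degree_at_most_poly:
  "degree p \<le> d \<Longrightarrow> degree_at_most d (\<lambda>n. poly p (of_int n))"
proof (induction d arbitrary: p)
  case 0
  then obtain c where "p = [:c:]" by (auto elim: degree_eq_zeroE)
  then show ?case by simp
next
  case (Suc d)
  have "degree_at_most d (\<lambda>n. poly (pcompose p [:of_int h, 1:] - p) (of_int n))" for h
    using Suc by (intro Suc.IH degree_difference)
  then show ?case by (simp add: poly_pcompose add.commute)
qed

lemma power_mean_two_power:
  fixes a :: "'b \<Rightarrow> real"
  assumes "finite B" "B \<noteq> {}" "\<And>h. h \<in> B \<Longrightarrow> a h \<ge> 0"
  shows "((\<Sum>h\<in>B. a h) / card B) ^ (2 ^ k) \<le> (\<Sum>h\<in>B. a h ^ (2 ^ k)) / card B"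
  using assms(3)
proof (induction k arbitrary: a)
  case (Suc k)
  have B: "real (card B) > 0" using assms by (simp add: card_gt_0_iff)
  have "((\<Sum>h\<in>B. a h) / card B) ^ 2 \<le> (\<Sum>h\<in>B. (a h)\<^sup>2) / card B"
    using sum_squared_le_sum_of_squares[of a B] assms(1) B
    by (simp add: power_divide power2_eq_square divide_simps mult_ac)
  then have "(((\<Sum>h\<in>B. a h) / card B) ^ 2) ^ (2 ^ k) \<le> ((\<Sum>h\<in>B. (a h)\<^sup>2) / card B) ^ (2 ^ k)"
    by (intro power_mono) auto
  also have "\<dots> \<le> (\<Sum>h\<in>B. ((a h)\<^sup>2) ^ (2 ^ k)) / card B"
    by (rule Suc.IH) simp
  finally show ?case by (simp add: power_mult[symmetric])
qed simp

definition lists_of :: "'b set \<Rightarrow> nat \<Rightarrow> 'b list set" where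
  "lists_of B k = {xs. set xs \<subseteq> B \<and> length xs = k}"

lemma lists_of_0 [simp]: "lists_of B 0 = {[]}"
  by (auto simp: lists_of_def)

lemma finite_lists_of [simp]: "finite B \<Longrightarrow> finite (lists_of B k)"
  unfolding lists_of_def by (rule finite_lists_length_eq)

lemma card_lists_of: "finite B \<Longrightarrow> card (lists_of B k) = card B ^ k"
  unfolding lists_of_def by (rule card_lists_length_eq)

lemma sum_lists_of_Suc:
  assumes "finite B"
  shows "(\<Sum>xs\<in>lists_of B (Suc k). F xs) = (\<Sum>x\<in>B. \<Sum>xs\<in>lists_of B k. F (x # xs))"
proof -
  have "lists_of B (Suc k) = (\<lambda>(x, xs). x # xs) ` (B \<times> lists_of B k)"
    by (auto simp: lists_of_def length_Suc_conv image_iff)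
  moreover have "inj_on (\<lambda>(x, xs). x # xs) (B \<times> lists_of B k)" by (auto simp: inj_on_def)
  ultimately have "(\<Sum>xs\<in>lists_of B (Suc k). F xs) = (\<Sum>(x, xs)\<in>B \<times> lists_of B k. F (x # xs))"
    by (simp add: sum.reindex case_prod_unfold)
  then show ?thesis by (simp add: sum.cartesian_product)
qed

text \<open>The head of a list is the base point and the tail the sides of a cube, so this is an
  unnormalised Gowers-type inner product. Keeping all variables in one list lets their digits be
  split off simultaneously.\<close>

definition cube_sum :: "int set \<Rightarrow> nat \<Rightarrow> (bool list \<Rightarrow> int \<Rightarrow> complex) \<Rightarrow> complex" where
  "cube_sum B k G = (\<Sum>xs\<in>lists_of B (Suc k). cube (tl xs) G (hd xs))"

lemma cube_sum_0: "finite B \<Longrightarrow> cube_sum B 0 (\<lambda>_. g) = (\<Sum>n\<in>B. g n)"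
  by (simp add: cube_sum_def sum_lists_of_Suc)

lemma cube_sum_Suc:
  assumes "finite B"
  shows "cube_sum B (Suc k) (\<lambda>_. g) = (\<Sum>h\<in>B. cube_sum B k (\<lambda>_ n. g (n + h) * cnj (g n)))"
proof -
  have "cube (h # hs) (\<lambda>_. g) n = cube hs (\<lambda>_ n. g (n + h) * cnj (g n)) n" for h hs n
    using cube_mult[of hs "\<lambda>_ n. g (n + h)" "\<lambda>_ n. cnj (g n)" n]
      cube_translate[of hs "\<lambda>_. g" h n] cube_cnj[of hs "\<lambda>_. g" n] by simp
  then have "cube_sum B (Suc k) (\<lambda>_. g)
      = (\<Sum>n\<in>B. \<Sum>h\<in>B. \<Sum>hs\<in>lists_of B k. cube hs (\<lambda>_ n. g (n + h) * cnj (g n)) n)"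
    unfolding cube_sum_def sum_lists_of_Suc[OF assms] by simp
  also have "\<dots> = (\<Sum>h\<in>B. \<Sum>n\<in>B. \<Sum>hs\<in>lists_of B k. cube hs (\<lambda>_ n. g (n + h) * cnj (g n)) n)"
    by (rule sum.swap)
  finally show ?thesis
    unfolding cube_sum_def sum_lists_of_Suc[OF assms] by simp
qed

text \<open>Two points \<open>n\<close> and \<open>n + h\<close> of the support
  \<open>{0..<N}\<close> differ by an \<open>h\<close> in \<open>{-N..<N}\<close>, so the symmetric
  box captures every pair.\<close>

lemma weyl_differencing:
  fixes g :: "int \<Rightarrow> complex"
  assumes supp: "\<And>n. n \<notin> {0..<N} \<Longrightarrow> g n = 0"
  shows "(\<Sum>n\<in>{-N..<N}. g n) * cnj (\<Sum>n\<in>{-N..<N}. g n)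
    = (\<Sum>h\<in>{-N..<N}. \<Sum>n\<in>{-N..<N}. g (n + h) * cnj (g n))"
proof -
  have *: "(\<Sum>h\<in>{-N..<N}. g (n + h) * cnj (g n)) = (\<Sum>m\<in>{-N..<N}. g m) * cnj (g n)" if "n \<in> {-N..<N}" for n
  proof (cases "n \<in> {0..<N}")
    case True
    have "(\<Sum>h\<in>{-N..<N}. g (n + h)) = (\<Sum>m\<in>{n-N..<n+N}. g m)"
      by (rule sum.reindex_bij_witness[of _ "\<lambda>m. m - n" "\<lambda>h. n + h"]) auto
    also have "\<dots> = (\<Sum>m\<in>{0..<N}. g m)"
      using True by (intro sum.mono_neutral_right) (auto intro!: supp)
    also have "\<dots> = (\<Sum>m\<in>{-N..<N}. g m)"
      by (intro sum.mono_neutral_left) (auto intro!: supp)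
    finally show ?thesis by (simp only: sum_distrib_right[symmetric])
  qed (simp add: supp)
  have "(\<Sum>h\<in>{-N..<N}. \<Sum>n\<in>{-N..<N}. g (n + h) * cnj (g n))
      = (\<Sum>n\<in>{-N..<N}. \<Sum>h\<in>{-N..<N}. g (n + h) * cnj (g n))" by (rule sum.swap)
  also have "\<dots> = (\<Sum>n\<in>{-N..<N}. (\<Sum>m\<in>{-N..<N}. g m) * cnj (g n))"
    by (intro sum.cong refl *)
  finally show ?thesis by (simp add: sum_distrib_left)
qed

text \<open>Each differencing squares the sum and lowers the degree of the phase by one; a constant
  phase disappears in the last squaring. This takes d + 1 squarings and leaves d + 2 variables, each
  ranging over a box of \<open>2 * N\<close> points.\<close>

lemma van_der_corput:
  fixes g :: "int \<Rightarrow> complex"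
  assumes "N > 0" "\<And>n. n \<notin> {0..<N} \<Longrightarrow> g n = 0" "degree_at_most d P"
  shows "(norm (\<Sum>n\<in>{-N..<N}. g n * e (P n)) / (2 * of_int N)) ^ (2 ^ Suc d)
       \<le> Re (cube_sum {-N..<N} (Suc d) (\<lambda>_. g)) / (2 * of_int N) ^ (d + 2)"
  using assms(2,3)
proof (induction d arbitrary: g P)
  case 0
  let ?B = "{-N..<N}"
  have P: "P n = P 0" for n using 0 by simp
  have "(\<Sum>n\<in>?B. g n * e (P n)) = (\<Sum>n\<in>?B. g n) * e (P 0)"
    unfolding sum_distrib_right using P by (intro sum.cong refl) metis
  then have "norm (\<Sum>n\<in>?B. g n * e (P n)) ^ 2 = Re ((\<Sum>n\<in>?B. g n) * cnj (\<Sum>n\<in>?B. g n))"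
    by (simp add: norm_mult complex_norm_square[symmetric] del: cnj_sum)
  also have "\<dots> = Re (cube_sum ?B (Suc 0) (\<lambda>_. g))"
    by (subst weyl_differencing) (use 0 in \<open>simp_all add: cube_sum_Suc cube_sum_0\<close>)
  finally show ?case by (simp add: power_divide power2_eq_square)
next
  case (Suc d)
  let ?B = "{-N..<N}"
  have card: "real (card ?B) = 2 * of_int N" using assms(1) by simp
  define S where "S h = (\<Sum>n\<in>?B. (g (n + h) * cnj (g n)) * e (P (n + h) - P n))" for h
  let ?g = "\<lambda>n. g n * e (P n)"
  have IH: "(norm (S h) / (2 * of_int N)) ^ (2 ^ Suc d)
      \<le> Re (cube_sum ?B (Suc d) (\<lambda>_ n. g (n + h) * cnj (g n))) / (2 * of_int N) ^ (d + 2)" for h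
    unfolding S_def using Suc.prems by (intro Suc.IH) auto
  have "norm (\<Sum>n\<in>?B. ?g n) ^ 2 = norm ((\<Sum>n\<in>?B. ?g n) * cnj (\<Sum>n\<in>?B. ?g n))"
    by (simp add: norm_mult power2_eq_square del: cnj_sum)
  also have "\<dots> = norm (\<Sum>h\<in>?B. S h)"
  proof -
    have "?g (n + h) * cnj (?g n) = (g (n + h) * cnj (g n)) * e (P (n + h) - P n)" for n h
      by (simp add: e_diff)
    moreover have "(\<Sum>n\<in>?B. ?g n) * cnj (\<Sum>n\<in>?B. ?g n) = (\<Sum>h\<in>?B. \<Sum>n\<in>?B. ?g (n + h) * cnj (?g n))"
      using Suc.prems(1) by (intro weyl_differencing) simp
    ultimately show ?thesis by (simp only: S_def)
  qed
  also have "\<dots> \<le> (\<Sum>h\<in>?B. norm (S h))" by (rule norm_sum)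
  finally have "norm (\<Sum>n\<in>?B. ?g n) ^ 2 / (2 * of_int N) ^ 2 \<le> (\<Sum>h\<in>?B. norm (S h)) / (2 * of_int N) ^ 2"
    by (intro divide_right_mono) auto
  then have "(norm (\<Sum>n\<in>?B. ?g n) / (2 * of_int N)) ^ 2 \<le> (\<Sum>h\<in>?B. norm (S h) / (2 * of_int N)) / card ?B"
    unfolding card by (simp add: power_divide sum_divide_distrib[symmetric] power2_eq_square)
  then have "((norm (\<Sum>n\<in>?B. ?g n) / (2 * of_int N)) ^ 2) ^ (2 ^ Suc d)
      \<le> ((\<Sum>h\<in>?B. norm (S h) / (2 * of_int N)) / card ?B) ^ (2 ^ Suc d)"
    by (intro power_mono) auto
  \<comment> \<open>The power mean moves the exponent inside the average over \<open>h\<close>,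
    where the induction hypothesis applies: \<open>g (n + h) * cnj (g n)\<close> again vanishes off
    \<open>{0..<N}\<close>.\<close>
  also have "\<dots> \<le> (\<Sum>h\<in>?B. (norm (S h) / (2 * of_int N)) ^ (2 ^ Suc d)) / card ?B"
    using assms(1) by (intro power_mean_two_power) auto
  also have "\<dots> \<le> (\<Sum>h\<in>?B. Re (cube_sum ?B (Suc d) (\<lambda>_ n. g (n + h) * cnj (g n))) / (2 * of_int N) ^ (d + 2)) / card ?B"
    by (intro divide_right_mono sum_mono IH) auto
  also have "\<dots> = Re (cube_sum ?B (Suc (Suc d)) (\<lambda>_. g)) / (2 * of_int N) ^ (Suc d + 2)"
    unfolding card by (subst cube_sum_Suc[of _ "Suc d"]) (simp_all add: sum_divide_distrib[symmetric])
  finally show ?case by (simp add: power_mult[symmetric])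
qed

subsection \<open>Carries\<close>

fun dot :: "bool list \<Rightarrow> int list \<Rightarrow> int" where
  "dot (b # \<omega>) (h # hs) = (if b then h else 0) + dot \<omega> hs"
| "dot _ _ = 0"

lemma dot_bounds: "(\<And>h. h \<in> set hs \<Longrightarrow> h \<ge> 0) \<Longrightarrow> 0 \<le> dot \<omega> hs \<and> dot \<omega> hs \<le> sum_list hs"
  by (induction \<omega> hs rule: dot.induct) (auto simp: sum_list_nonneg add_increasing add_mono)

lemma int_div_less_iff:
  fixes x M Q :: int
  assumes "Q > 0" shows "x div Q < M \<longleftrightarrow> x < Q * M"
proof
  assume "x div Q < M"
  then have "Q * (x div Q + 1) \<le> Q * M" using assms by (intro mult_left_mono) auto
  moreover have "x < Q * (x div Q + 1)"
    using pos_mod_bound[OF assms, of x] mult_div_mod_eq[of Q x] unfolding distrib_left mult_1_right by linarith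
  ultimately show "x < Q * M" by linarith
next
  assume "x < Q * M"
  show "x div Q < M"
  proof (rule ccontr)
    assume "\<not> x div Q < M"
    then have "Q * M \<le> Q * (x div Q)" using assms by (intro mult_left_mono) auto
    also have "\<dots> \<le> x" using pos_mod_sign[OF assms, of x] mult_div_mod_eq[of Q x] by linarith
    finally show False using \<open>x < Q * M\<close> by simp
  qed
qed

definition recombine :: "int \<Rightarrow> int list \<Rightarrow> int list \<Rightarrow> int list" where
  "recombine Q ds ys = map2 (\<lambda>d y. d + Q * y) ds ys"

lemma recombine_Cons [simp]: "recombine Q (d # ds) (y # ys) = (d + Q * y) # recombine Q ds ys"
  by (simp add: recombine_def)

text \<open>Floor division maps a symmetric box to a shorter symmetric box, with remainders still in
  \<open>{0..<Q}\<close>, so negative numbers need no separate treatment.\<close>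

lemma sum_digit_split:
  fixes Q M :: int and F :: "int \<Rightarrow> complex"
  assumes "Q > 0"
  shows "(\<Sum>x\<in>{-(Q * M)..<Q * M}. F x) = (\<Sum>d\<in>{0..<Q}. \<Sum>y\<in>{-M..<M}. F (d + Q * y))"
proof -
  have div: "- M \<le> x div Q" "x div Q < M" if "- (Q * M) \<le> x" "x < Q * M" for x
    using that int_div_less_iff[OF assms, of x "- M"] int_div_less_iff[OF assms, of x M] by auto
  have rng: "- (Q * M) \<le> d + Q * y" "d + Q * y < Q * M" if "0 \<le> d" "d < Q" "- M \<le> y" "y < M" for d y
  proof -
    have "Q * (- M) \<le> Q * y" using that assms by (intro mult_left_mono) auto
    then show "- (Q * M) \<le> d + Q * y" using that by simp
    have "Q * (y + 1) \<le> Q * M" using that assms by (intro mult_left_mono) auto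
    then show "d + Q * y < Q * M" using that by (simp add: distrib_left)
  qed
  have "(\<Sum>x\<in>{-(Q * M)..<Q * M}. F x) = (\<Sum>(d, y)\<in>{0..<Q} \<times> {-M..<M}. F (d + Q * y))"
    using assms div rng
    by (intro sum.reindex_bij_witness[of _ "\<lambda>(d, y). d + Q * y" "\<lambda>x. (x mod Q, x div Q)"]) auto
  then show ?thesis by (simp add: sum.cartesian_product)
qed

lemma sum_lists_digit_split:
  fixes Q M :: int and F :: "int list \<Rightarrow> complex"
  assumes "Q > 0"
  shows "(\<Sum>xs\<in>lists_of {-(Q * M)..<Q * M} k. F xs)
       = (\<Sum>ds\<in>lists_of {0..<Q} k. \<Sum>ys\<in>lists_of {-M..<M} k. F (recombine Q ds ys))"
proof (induction k arbitrary: F)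
  case (Suc k)
  have "(\<Sum>xs\<in>lists_of {-(Q * M)..<Q * M} (Suc k). F xs)
      = (\<Sum>d\<in>{0..<Q}. \<Sum>y\<in>{-M..<M}. \<Sum>ds\<in>lists_of {0..<Q} k. \<Sum>ys\<in>lists_of {-M..<M} k.
           F (recombine Q (d # ds) (y # ys)))"
    by (simp add: sum_lists_of_Suc sum_digit_split[OF assms] Suc.IH)
  also have "\<dots> = (\<Sum>d\<in>{0..<Q}. \<Sum>ds\<in>lists_of {0..<Q} k. \<Sum>y\<in>{-M..<M}. \<Sum>ys\<in>lists_of {-M..<M} k.
           F (recombine Q (d # ds) (y # ys)))"
    by (intro sum.cong refl sum.swap)
  finally show ?case by (simp add: sum_lists_of_Suc)
qed (simp add: recombine_def)

text \<open>Adding a cube digit by digit: the lowest digits contribute the first factor, and the carries they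
  produce become the shifts of the cube formed by the remaining digits.\<close>

lemma cube_digit_split:
  fixes Q :: int
  assumes g: "\<And>x. g x = a (x mod Q) * g' (x div Q)" and "Q > 0" and "length ds = length ys"
  shows "cube (recombine Q ds ys) (\<lambda>\<omega> x. g (x + r \<omega>)) (n + Q * n')
       = cube ds (\<lambda>\<omega> x. a ((x + r \<omega>) mod Q)) n
         * cube ys (\<lambda>\<omega> y. g' (y + (n + dot \<omega> ds + r \<omega>) div Q)) n'"
  using assms(3)
proof (induction ds ys arbitrary: r n n' rule: list_induct2)
  case Nil
  have "(n + Q * n' + r []) mod Q = (n + r []) mod Q" "(n + Q * n' + r []) div Q = n' + (n + r []) div Q"
    using \<open>Q > 0\<close> mod_mult_self1[of "n + r []" n' Q] div_mult_self1[of Q "n + r []" n']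
    by (simp_all add: ac_simps)
  then show ?case by (simp add: recombine_def g)
next
  case (Cons d ds y ys)
  have n: "n + Q * n' + (d + Q * y) = (n + d) + Q * (n' + y)" by (simp add: algebra_simps)
  show ?case
    unfolding recombine_Cons cube.simps n Cons.IH by (simp add: add.assoc mult_ac)
qed

section \<open>Transfer operators acting on carry vectors\<close>

definition digit_window :: "(nat \<Rightarrow> complex) \<Rightarrow> nat \<Rightarrow> nat \<Rightarrow> nat \<Rightarrow> int \<Rightarrow> complex" where
  "digit_window f Q i m x = (if 0 \<le> x \<and> x < int Q ^ m then f (Q ^ i * nat x) else 0)"

lemma digit_window_Suc:
  assumes "q_multiplicative Q f" "Q > 0"
  shows "digit_window f Q i (Suc m) x
       = f (Q ^ i * nat (x mod int Q)) * digit_window f Q (Suc i) m (x div int Q)"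
proof -
  have iff: "0 \<le> x \<and> x < int Q ^ Suc m \<longleftrightarrow> 0 \<le> x div int Q \<and> x div int Q < int Q ^ m"
    using assms(2) by (simp add: pos_imp_zdiv_nonneg_iff int_div_less_iff)
  show ?thesis
  proof (cases "0 \<le> x \<and> x < int Q ^ Suc m")
    case True
    then have "x \<ge> 0" by simp
    have "nat x = nat (x mod int Q) + Q * nat (x div int Q)"
      using \<open>x \<ge> 0\<close> assms(2) by (simp add: nat_mod_distrib nat_div_distrib)
    then have "Q ^ i * nat x = Q ^ i * nat (x mod int Q) + Q ^ Suc i * nat (x div int Q)"
      by (simp add: algebra_simps)
    moreover have "Q ^ i * nat (x mod int Q) < Q ^ Suc i"
      using assms(2) by (simp add: nat_less_iff)
    ultimately have "f (Q ^ i * nat x) = f (Q ^ i * nat (x mod int Q)) * f (Q ^ Suc i * nat (x div int Q))"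
      using q_multiplicativeD[OF assms(1)] by presburger
    then show ?thesis using True iff by (simp add: digit_window_def)
  next
    case False
    then show ?thesis using iff by (auto simp: digit_window_def)
  qed
qed

text \<open>\<open>r \<omega>\<close> is the carry arriving at the vertex \<open>\<omega>\<close>
  from lower digits. With \<open>i = 0\<close> and zero carries this is the cube sum produced by van
  der Corput differencing.\<close>

definition carry_sum :: "(nat \<Rightarrow> complex) \<Rightarrow> nat \<Rightarrow> nat \<Rightarrow> nat \<Rightarrow> nat \<Rightarrow> (bool list \<Rightarrow> int) \<Rightarrow> complex" where
  "carry_sum f Q k i m r = cube_sum {- (int Q ^ m)..<int Q ^ m} k (\<lambda>\<omega> x. digit_window f Q i m (x + r \<omega>))"

definition digit_weight :: "(nat \<Rightarrow> complex) \<Rightarrow> nat \<Rightarrow> nat \<Rightarrow> (bool list \<Rightarrow> int) \<Rightarrow> int list \<Rightarrow> complex" where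
  "digit_weight f Q i r ds = cube (tl ds) (\<lambda>\<omega> x. f (Q ^ i * nat ((x + r \<omega>) mod int Q))) (hd ds)"

definition carry :: "nat \<Rightarrow> (bool list \<Rightarrow> int) \<Rightarrow> int list \<Rightarrow> bool list \<Rightarrow> int" where
  "carry Q r ds \<omega> = (hd ds + dot \<omega> (tl ds) + r \<omega>) div int Q"

lemma carry_sum_Suc:
  assumes "q_multiplicative Q f" "Q > 0"
  shows "carry_sum f Q k i (Suc m) r
       = (\<Sum>ds\<in>lists_of {0..<int Q} (Suc k). digit_weight f Q i r ds * carry_sum f Q k (Suc i) m (carry Q r ds))"
proof -
  let ?B = "{- (int Q ^ m)..<int Q ^ m}"
  let ?G = "\<lambda>\<omega> x. digit_window f Q i (Suc m) (x + r \<omega>)"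
  have "carry_sum f Q k i (Suc m) r
      = (\<Sum>ds\<in>lists_of {0..<int Q} (Suc k). \<Sum>ys\<in>lists_of ?B (Suc k).
           cube (tl (recombine (int Q) ds ys)) ?G (hd (recombine (int Q) ds ys)))"
    using assms(2) sum_lists_digit_split[of "int Q" _ "int Q ^ m"] by (simp add: carry_sum_def cube_sum_def)
  also have "\<dots> = (\<Sum>ds\<in>lists_of {0..<int Q} (Suc k). \<Sum>ys\<in>lists_of ?B (Suc k).
      digit_weight f Q i r ds * cube (tl ys) (\<lambda>\<omega> y. digit_window f Q (Suc i) m (y + carry Q r ds \<omega>)) (hd ys))"
  proof (intro sum.cong refl)
    fix ds ys assume "ds \<in> lists_of {0..<int Q} (Suc k)" "ys \<in> lists_of ?B (Suc k)"
    then obtain n ds' n' ys' where ds: "ds = n # ds'" "length ds' = k" and ys: "ys = n' # ys'" "length ys' = k"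
      by (auto simp: lists_of_def length_Suc_conv)
    have "cube (recombine (int Q) ds' ys') ?G (n + int Q * n')
       = cube ds' (\<lambda>\<omega> x. f (Q ^ i * nat ((x + r \<omega>) mod int Q))) n
         * cube ys' (\<lambda>\<omega> y. digit_window f Q (Suc i) m (y + (n + dot \<omega> ds' + r \<omega>) div int Q)) n'"
      using assms(2) ds ys
      by (intro cube_digit_split[where a = "\<lambda>x. f (Q ^ i * nat x)"] digit_window_Suc assms) auto
    then show "cube (tl (recombine (int Q) ds ys)) ?G (hd (recombine (int Q) ds ys))
       = digit_weight f Q i r ds * cube (tl ys) (\<lambda>\<omega> y. digit_window f Q (Suc i) m (y + carry Q r ds \<omega>)) (hd ys)"
      by (simp add: ds ys digit_weight_def carry_def)
  qed
  also have "\<dots> = (\<Sum>ds\<in>lists_of {0..<int Q} (Suc k). digit_weight f Q i r ds * carry_sum f Q k (Suc i) m (carry Q r ds))"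
    by (simp add: carry_sum_def cube_sum_def sum_distrib_left)
  finally show ?thesis .
qed

text \<open>At most k + 1 digits of size at most Q - 1 and an old carry of at most \<open>k\<close>
  sum to less than Q(k + 1).\<close>

lemma carry_bounds:
  assumes ds: "ds \<in> lists_of {0..<int Q} (Suc k)" and "Q > 0" and r: "\<And>\<omega>. 0 \<le> r \<omega> \<and> r \<omega> \<le> int k"
  shows "0 \<le> carry Q r ds \<omega> \<and> carry Q r ds \<omega> \<le> int k"
proof -
  obtain n hs where hs: "ds = n # hs" "length hs = k" "0 \<le> n" "n < int Q" "set hs \<subseteq> {0..<int Q}"
    using ds by (auto simp: lists_of_def length_Suc_conv)
  have "sum_list hs \<le> int (length hs) * (int Q - 1)"
    using hs(5) by (induction hs) (auto simp: algebra_simps)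
  then have sl: "sum_list hs \<le> int k * (int Q - 1)" by (simp add: hs(2))
  have d: "0 \<le> dot \<omega> hs \<and> dot \<omega> hs \<le> sum_list hs"
    using hs(5) by (intro dot_bounds) auto
  have "n + dot \<omega> hs + r \<omega> < int Q * (int k + 1)"
    using d sl r[of \<omega>] hs(4) by (simp add: algebra_simps)
  then have "carry Q r ds \<omega> < int k + 1"
    using assms(2) by (simp add: carry_def hs(1) int_div_less_iff del: zle_add1_eq_le)
  moreover have "0 \<le> n + dot \<omega> hs + r \<omega>" using hs(3) d r[of \<omega>] by simp
  then have "0 \<le> carry Q r ds \<omega>"
    using assms(2) by (simp add: carry_def hs(1) pos_imp_zdiv_nonneg_iff)
  ultimately show ?thesis by simp
qed

lemma norm_digit_weight: "(\<And>n. norm (f n) = 1) \<Longrightarrow> norm (digit_weight f Q i r ds) = 1"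
  unfolding digit_weight_def by (intro norm_cube_eq_1)

lemma dot_replicate_0: "dot \<omega> (replicate k 0) = 0"
  by (induction k arbitrary: \<omega>; case_tac \<omega>) auto

text \<open>Since \<open>k < Q\<close>, zero digits absorb any admissible carry vector. The zero
  carry state is therefore reachable from every state in one step.\<close>

lemma carry_replicate_0:
  assumes "\<And>\<omega>. 0 \<le> r \<omega> \<and> r \<omega> \<le> int k" "k < Q"
  shows "carry Q r (replicate (Suc k) 0) = (\<lambda>_. 0)"
proof
  fix \<omega>
  show "carry Q r (replicate (Suc k) 0) \<omega> = 0"
    using assms(1)[of \<omega>] assms(2) by (auto simp: carry_def dot_replicate_0 intro!: div_pos_pos_trivial)
qed

lemma cube_replicate_0: "(\<And>\<omega>. G \<omega> 0 = 1) \<Longrightarrow> cube (replicate k (0::int)) G 0 = 1"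
  by (induction k arbitrary: G) simp_all

lemma digit_weight_replicate_0: "f 0 = 1 \<Longrightarrow> digit_weight f Q i (\<lambda>_. 0) (replicate (Suc k) 0) = 1"
  by (simp add: digit_weight_def cube_replicate_0)

text \<open>A cube contained in \<open>{0..<Q}\<close> produces no carry, which gives further paths
  from the zero state to itself besides the zero digits.\<close>

lemma carry_no_overflow:
  assumes "n + sum_list hs < Q"
  shows "carry Q (\<lambda>_. 0) (map int (n # hs)) = (\<lambda>_. 0)"
proof
  fix \<omega>
  have "sum_list (map int hs) = int (sum_list hs)" by (induction hs) auto
  moreover have "0 \<le> dot \<omega> (map int hs) \<and> dot \<omega> (map int hs) \<le> sum_list (map int hs)"
    by (rule dot_bounds) auto
  ultimately show "carry Q (\<lambda>_. 0) (map int (n # hs)) \<omega> = 0"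
    using assms by (auto simp: carry_def intro!: div_pos_pos_trivial)
qed

lemma cube_no_overflow:
  assumes "n + sum_list hs < Q"
  shows "cube (map int hs) (\<lambda>_ x. u (nat (x mod int Q))) (int n) = cube hs (\<lambda>_. u) n"
  using assms
proof (induction hs arbitrary: n)
  case Nil
  then show ?case by (simp add: nat_mod_distrib)
next
  case (Cons h hs)
  show ?case using Cons.IH[of "n + h"] Cons.IH[of n] Cons.prems by simp
qed

text \<open>The parallelogram law bounds the square by 4 - \<delta>^2, which is at most (2 -
  \<delta>^2/4)^2.\<close>

lemma norm_one_plus_unimodular:
  fixes W :: complex
  assumes "norm W = 1" "\<delta> \<le> norm (W - 1)" "\<delta> \<ge> 0"
  shows "norm (1 + W) \<le> 2 - \<delta>\<^sup>2 / 4"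
proof -
  have "(norm (1 + W))\<^sup>2 + (norm (W - 1))\<^sup>2 = 2 + 2 * (norm W)\<^sup>2"
    unfolding cmod_power2 by (simp add: power2_sum power2_diff)
  moreover have "\<delta>\<^sup>2 \<le> (norm (W - 1))\<^sup>2" using assms by (intro power_mono)
  ultimately have "(norm (1 + W))\<^sup>2 \<le> 4 - \<delta>\<^sup>2" using assms(1) by simp
  also have "\<dots> \<le> (2 - \<delta>\<^sup>2 / 4)\<^sup>2"
  proof -
    have "(2 - x)\<^sup>2 = 4 - 4 * x + x\<^sup>2" for x :: real by (simp add: power2_diff)
    from this[of "\<delta>\<^sup>2 / 4"] show ?thesis by simp
  qed
  finally have sq: "(norm (1 + W))\<^sup>2 \<le> (2 - \<delta>\<^sup>2 / 4)\<^sup>2" .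
  have "norm (W - 1) \<le> 2" using norm_triangle_ineq4[of W 1] assms(1) by simp
  then have "\<delta> \<le> 2" using assms(2) by linarith
  have "\<delta>\<^sup>2 \<le> 2\<^sup>2" by (rule power_mono[OF \<open>\<delta> \<le> 2\<close> assms(3)])
  then have "0 \<le> 2 - \<delta>\<^sup>2 / 4" by simp
  then show ?thesis by (rule power2_le_imp_le[OF sq])
qed

subsection \<open>Contraction of carry sums\<close>

lemma norm_sum_unimodular_remove:
  fixes w a :: "'b \<Rightarrow> complex"
  assumes "finite X" "x \<in> X" "\<And>y. y \<in> X \<Longrightarrow> norm (w y) = 1" "\<And>y. y \<in> X \<Longrightarrow> norm (a y) \<le> M"
  shows "norm (\<Sum>y\<in>X. w y * a y) \<le> (real (card X) - 1) * M + norm (a x)"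
proof -
  have "norm (\<Sum>y\<in>X. w y * a y) \<le> norm (w x * a x) + norm (\<Sum>y\<in>X - {x}. w y * a y)"
    by (subst sum.remove[OF assms(1,2)]) (rule norm_triangle_ineq)
  also have "norm (\<Sum>y\<in>X - {x}. w y * a y) \<le> (\<Sum>y\<in>X - {x}. M)"
    using assms by (intro sum_norm_le) (auto simp: norm_mult)
  also have "\<dots> = (real (card X) - 1) * M"
  proof -
    have "card X \<ge> 1" using assms(1,2) by (auto simp: Suc_le_eq card_gt_0_iff)
    then show ?thesis using assms(1,2) by (simp add: of_nat_diff)
  qed
  finally show ?thesis using assms by (simp add: norm_mult)
qed

text \<open>The terms at \<open>x\<close> and \<open>x'\<close> share one amplitude but have weights
  at distance at least \<open>\<delta>\<close>, so together they lose \<delta>^2/4 against the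
  trivial bound 2.\<close>

lemma norm_sum_unimodular_cancel:
  fixes w a :: "'b \<Rightarrow> complex"
  assumes "finite X" "x \<in> X" "x' \<in> X" "\<And>y. y \<in> X \<Longrightarrow> norm (w y) = 1" "\<And>y. y \<in> X \<Longrightarrow> norm (a y) \<le> M"
    and "w x = 1" "a x' = a x" "\<delta> \<le> norm (w x' - 1)" "\<delta> > 0"
  shows "norm (\<Sum>y\<in>X. w y * a y) \<le> (real (card X) - \<delta>\<^sup>2 / 4) * M"
proof -
  have ne: "x \<noteq> x'" using assms by auto
  let ?X = "X - {x} - {x'}"
  have c: "card X \<ge> 2" using card_mono[of X "{x, x'}"] assms(1-3) ne by simp
  have "(\<Sum>y\<in>X. w y * a y) = (1 + w x') * a x + (\<Sum>y\<in>?X. w y * a y)"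
    using assms(1-3,6,7) ne by (simp add: sum.remove[of X x] sum.remove[of "X - {x}" x'] distrib_right)
  then have "norm (\<Sum>y\<in>X. w y * a y) \<le> norm (1 + w x') * norm (a x) + norm (\<Sum>y\<in>?X. w y * a y)"
    using norm_triangle_ineq[of "(1 + w x') * a x"] by (simp add: norm_mult)
  also have "norm (\<Sum>y\<in>?X. w y * a y) \<le> (\<Sum>y\<in>?X. M)"
    using assms by (intro sum_norm_le) (auto simp: norm_mult)
  also have "\<dots> = (real (card X) - 2) * M"
    using assms(1-3) ne c by (simp add: of_nat_diff)
  also have "norm (1 + w x') * norm (a x) \<le> (2 - \<delta>\<^sup>2 / 4) * M"
  proof (intro mult_mono)
    show "norm (1 + w x') \<le> 2 - \<delta>\<^sup>2 / 4" using assms by (intro norm_one_plus_unimodular) auto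
    then show "0 \<le> 2 - \<delta>\<^sup>2 / 4" using norm_ge_zero[of "1 + w x'"] by linarith
  qed (use assms in auto)
  finally show ?thesis by (simp add: algebra_simps)
qed

lemma card_strict_window_eq:
  fixes bad :: "nat \<Rightarrow> bool"
  assumes "\<not> bad (Suc i)"
  shows "card {j\<in>{i<..<i + Suc (Suc m)}. bad j} = card {j\<in>{Suc i<..<Suc i + Suc m}. bad j}"
proof -
  have "{j\<in>{i<..<i + Suc (Suc m)}. bad j} = {j\<in>{Suc i<..<Suc i + Suc m}. bad j}"
    using assms by (auto simp: Suc_lessI) (metis Suc_lessI)
  then show ?thesis by simp
qed

lemma card_strict_window_le:
  fixes bad :: "nat \<Rightarrow> bool"
  shows "card {j\<in>{i<..<i + Suc (Suc m)}. bad j} \<le> 2 + card {j\<in>{Suc (Suc i)<..<Suc (Suc i) + m}. bad j}"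
proof -
  have "{j\<in>{i<..<i + Suc (Suc m)}. bad j} \<subseteq> {Suc i, Suc (Suc i)} \<union> {j\<in>{Suc (Suc i)<..<Suc (Suc i) + m}. bad j}"
    by auto
  then have "card {j\<in>{i<..<i + Suc (Suc m)}. bad j}
      \<le> card ({Suc i, Suc (Suc i)} \<union> {j\<in>{Suc (Suc i)<..<Suc (Suc i) + m}. bad j})"
    by (intro card_mono) auto
  also have "\<dots> \<le> card {Suc i, Suc (Suc i)} + card {j\<in>{Suc (Suc i)<..<Suc (Suc i) + m}. bad j}"
    by (rule card_Un_le)
  finally show ?thesis by simp
qed

text \<open>Zero digits in one block reset the carries to zero. If the next block is bad, the zero
  digits and some cube without overflow both lead from zero carries to zero carries, with weights
  more than \<open>\<delta>\<close> apart; their cancellation saves \<delta>^2/4 among the D^2 digit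
  choices of the two blocks. The first block only resets carries, so the exponent counts bad
  positions strictly after \<open>i\<close>.\<close>

lemma carry_sum_contraction:
  fixes k Q :: nat and \<delta> \<theta> :: real
  defines "D \<equiv> real Q ^ Suc k"
  assumes mult: "q_multiplicative Q f" and uni: "\<And>n. norm (f n) = 1" and "k < Q" "\<delta> > 0"
    and bad: "\<And>i. bad i \<longleftrightarrow> \<not> near_polynomial Q k \<delta> (\<lambda>n. f (Q ^ i * n))"
    and \<theta>: "0 \<le> \<theta>" "\<theta> \<le> 1" "D\<^sup>2 - \<delta>\<^sup>2 / 4 \<le> D\<^sup>2 * \<theta>\<^sup>2"
    and r: "\<And>\<omega>. 0 \<le> r \<omega> \<and> r \<omega> \<le> int k"
  shows "norm (carry_sum f Q k i m r) \<le> 2 ^ Suc k * D ^ m * \<theta> ^ card {j\<in>{i<..<i + m}. bad j}"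
proof -
  \<comment> \<open>For \<open>m = 0\<close> each of the k + 1 variables runs over the two points -1
    and 0, which is the source of the factor \<open>2 ^ Suc k\<close>.\<close>
  have base: "norm (carry_sum f Q k i 0 r) \<le> 2 ^ Suc k" for i r
  proof -
    have "norm (carry_sum f Q k i 0 r) \<le> (\<Sum>xs\<in>lists_of {-1..<1::int} (Suc k). 1)"
      unfolding carry_sum_def cube_sum_def power_0
      by (intro sum_norm_le norm_cube_le_1) (simp add: digit_window_def uni)
    then show ?thesis by (simp add: card_lists_of)
  qed
  show ?thesis
    using r
  \<comment> \<open>The argument advances by one block or by two, hence an induction with two
    predecessors.\<close>
  proof (induction m arbitrary: i r rule: induct_nat_012)
    case 0
    show ?case using base by simp
  next
    case 1
    let ?X = "lists_of {0..<int Q} (Suc k)"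
    have Q: "Q > 0" using \<open>k < Q\<close> by simp
    have "norm (carry_sum f Q k i (Suc 0) r) \<le> (\<Sum>ds\<in>?X. 2 ^ Suc k)"
      unfolding carry_sum_Suc[OF mult Q]
      using base by (intro sum_norm_le) (simp add: norm_mult norm_digit_weight uni)
    also have "\<dots> = 2 ^ Suc k * D" by (simp add: card_lists_of D_def)
    also have "\<dots> = 2 ^ Suc k * D ^ Suc 0 * \<theta> ^ card {j\<in>{i<..<i + Suc 0}. bad j}"
    proof -
      have "{j\<in>{i<..<i + Suc 0}. bad j} = {}" by auto
      then show ?thesis by (simp only: card.empty power_0 power_Suc0_right mult_1_right)
    qed
    finally show ?case .
  next
    case (ge2 m)
    let ?X = "lists_of {0..<int Q} (Suc k)"
    let ?z = "replicate (Suc k) (0::int)"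
    have Q: "Q > 0" using \<open>k < Q\<close> by simp
    have f0: "f 0 = 1" using q_multiplicative_0[OF mult uni] .
    have D: "D \<ge> 1" unfolding D_def using Q by (intro one_le_power) simp
    have cX: "real (card ?X) = D" by (simp add: card_lists_of D_def)
    have z: "?z \<in> ?X" using Q by (auto simp: lists_of_def)
    define M where "M = 2 ^ Suc k * D ^ m * \<theta> ^ card {j\<in>{Suc (Suc i)<..<Suc (Suc i) + m}. bad j}"
    have M0: "M \<ge> 0" using \<theta> D by (simp add: M_def)
    have M: "norm (carry_sum f Q k (Suc (Suc i)) m r) \<le> M" if "\<And>\<omega>. 0 \<le> r \<omega> \<and> r \<omega> \<le> int k" for r
      unfolding M_def using that by (rule ge2(1))
    have M1: "norm (carry_sum f Q k (Suc i) (Suc m) r) \<le> D * M" if "\<And>\<omega>. 0 \<le> r \<omega> \<and> r \<omega> \<le> int k" for r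
    proof -
      have "norm (carry_sum f Q k (Suc i) (Suc m) r) \<le> (\<Sum>ds\<in>?X. M)"
        unfolding carry_sum_Suc[OF mult Q] using carry_bounds[OF _ Q that]
        by (intro sum_norm_le) (simp add: norm_mult norm_digit_weight uni M)
      then show ?thesis using cX by simp
    qed
    have "norm (carry_sum f Q k i (Suc (Suc m)) r)
        \<le> 2 ^ Suc k * D ^ Suc (Suc m) * \<theta> ^ card {j\<in>{i<..<i + Suc (Suc m)}. bad j}"
    proof (cases "bad (Suc i)")
      \<comment> \<open>Advance one block by the trivial bound: \<open>Suc i\<close> is not bad, so
        the strict window keeps its number of bad positions.\<close>
      case False
      let ?M = "2 ^ Suc k * D ^ Suc m * \<theta> ^ card {j\<in>{Suc i<..<Suc i + Suc m}. bad j}"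
      have "norm (carry_sum f Q k i (Suc (Suc m)) r) \<le> (\<Sum>ds\<in>?X. ?M)"
        unfolding carry_sum_Suc[OF mult Q, of k i "Suc m"]
      proof (intro sum_norm_le)
        fix ds assume "ds \<in> ?X"
        then have "norm (carry_sum f Q k (Suc i) (Suc m) (carry Q r ds)) \<le> ?M"
          by (intro ge2(2) carry_bounds[where k = k] Q ge2(3))
        then show "norm (digit_weight f Q i r ds * carry_sum f Q k (Suc i) (Suc m) (carry Q r ds)) \<le> ?M"
          by (simp add: norm_mult norm_digit_weight uni)
      qed
      also have "\<dots> = D * ?M" using cX by simp
      finally show ?thesis unfolding card_strict_window_eq[of bad, OF False] by (simp add: mult_ac)
    next
      case True
      then obtain hs n where hs: "length hs = k" "n + sum_list hs < Q"
        and W: "\<delta> < norm (cube hs (\<lambda>_ n. f (Q ^ Suc i * n)) n - 1)"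
        unfolding bad near_polynomial_def by (auto simp: not_le)
      have ds: "map int (n # hs) \<in> ?X"
        using hs member_le_sum_list[of _ hs] by (fastforce simp: lists_of_def)
      have "norm (carry_sum f Q k (Suc i) (Suc m) (\<lambda>_. 0)) \<le> (real (card ?X) - \<delta>\<^sup>2 / 4) * M"
        unfolding carry_sum_Suc[OF mult Q, of k "Suc i" m]
      proof (rule norm_sum_unimodular_cancel[OF _ z ds])
        show "digit_weight f Q (Suc i) (\<lambda>_. 0) ?z = 1" using f0 by (rule digit_weight_replicate_0)
        show "carry_sum f Q k (Suc (Suc i)) m (carry Q (\<lambda>_. 0) (map int (n # hs)))
            = carry_sum f Q k (Suc (Suc i)) m (carry Q (\<lambda>_. 0) ?z)"
          unfolding carry_no_overflow[OF hs(2)] using \<open>k < Q\<close> by (subst carry_replicate_0) auto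
        have "digit_weight f Q (Suc i) (\<lambda>_. 0) (map int (n # hs)) = cube hs (\<lambda>_ n. f (Q ^ Suc i * n)) n"
          using cube_no_overflow[OF hs(2), of "\<lambda>n. f (Q ^ Suc i * n)"] by (simp add: digit_weight_def)
        then show "\<delta> \<le> norm (digit_weight f Q (Suc i) (\<lambda>_. 0) (map int (n # hs)) - 1)" using W by simp
        show "norm (carry_sum f Q k (Suc (Suc i)) m (carry Q (\<lambda>_. 0) y)) \<le> M" if "y \<in> ?X" for y
          by (intro M carry_bounds[OF that Q]) simp
      qed (simp_all add: norm_digit_weight uni \<open>\<delta> > 0\<close>)
      then have M2: "norm (carry_sum f Q k (Suc i) (Suc m) (\<lambda>_. 0)) \<le> (D - \<delta>\<^sup>2 / 4) * M" using cX by simp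
      have "norm (carry_sum f Q k i (Suc (Suc m)) r)
          \<le> (real (card ?X) - 1) * (D * M) + norm (carry_sum f Q k (Suc i) (Suc m) (carry Q r ?z))"
        unfolding carry_sum_Suc[OF mult Q, of k i "Suc m"]
        using M1 carry_bounds[OF _ Q ge2(3)]
        by (intro norm_sum_unimodular_remove z) (auto simp: norm_digit_weight uni)
      also have "carry Q r ?z = (\<lambda>_. 0)" using ge2(3) \<open>k < Q\<close> by (rule carry_replicate_0)
      also note M2
      also have "(real (card ?X) - 1) * (D * M) + (D - \<delta>\<^sup>2 / 4) * M = (D\<^sup>2 - \<delta>\<^sup>2 / 4) * M"
        unfolding cX by (simp add: algebra_simps power2_eq_square)
      also have "\<dots> \<le> (D\<^sup>2 * \<theta>\<^sup>2) * M" using \<theta>(3) M0 by (intro mult_right_mono)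
      \<comment> \<open>The factor \<theta>^2 pays for both \<open>Suc i\<close> and
        \<open>Suc (Suc i)\<close>; the latter falls out of the strict window at the new
        start.\<close>
      also have "\<dots> = 2 ^ Suc k * D ^ Suc (Suc m) * \<theta> ^ (2 + card {j\<in>{Suc (Suc i)<..<Suc (Suc i) + m}. bad j})"
        by (simp add: M_def power_add power2_eq_square)
      also have "\<dots> \<le> 2 ^ Suc k * D ^ Suc (Suc m) * \<theta> ^ card {j\<in>{i<..<i + Suc (Suc m)}. bad j}"
        using \<theta> D by (intro mult_left_mono power_decreasing card_strict_window_le) auto
      finally show ?thesis by simp
    qed
    then show ?case .
  qed
qed

section \<open>Power saving for sums with polynomial phases\<close>

lemma sum_digit_window:
  "(\<Sum>n\<in>{- (int Q ^ L)..<int Q ^ L}. digit_window f Q 0 L n * e (poly p (of_int n)))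
     = (\<Sum>n<Q ^ L. f n * e (poly p (real n)))"
proof -
  have "(\<Sum>n\<in>{- (int Q ^ L)..<int Q ^ L}. digit_window f Q 0 L n * e (poly p (of_int n)))
      = (\<Sum>n\<in>{0..<int Q ^ L}. digit_window f Q 0 L n * e (poly p (of_int n)))"
    by (intro sum.mono_neutral_right) (auto simp: digit_window_def)
  also have "\<dots> = (\<Sum>n<Q ^ L. f n * e (poly p (real n)))"
    by (rule sum.reindex_bij_witness[of _ int nat])
      (auto simp: digit_window_def nat_less_iff simp flip: of_nat_power)
  finally show ?thesis .
qed

text \<open>Bad blocks contract the carry sums, and the Gelfond bound makes a positive proportion of
  blocks bad up to a bounded defect. Van der Corput turns the decay of the cube sum into decay of
  the sum itself. Passing to a power \<open>Q\<close> of \<open>q\<close> makes one digit long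
  enough for the block estimates.\<close>

theorem q_multiplicative_weyl_sum_bound:
  assumes mult: "q_multiplicative q f" and q: "q \<ge> 2" and uni: "\<And>n. norm (f n) = 1"
    and "gelfond_type f"
  shows "\<exists>Q C \<rho>. Q \<ge> (2::nat) \<and> q_multiplicative Q f \<and> 0 < \<rho> \<and> \<rho> < 1 \<and> C \<ge> 0 \<and>
    (\<forall>p L. degree p \<le> d \<longrightarrow>
      norm (\<Sum>n<Q ^ L. f n * e (poly p (real n))) \<le> C * \<rho> ^ L * real (Q ^ L))"
proof -
  obtain c C0 where c: "c > 0" and C0: "\<And>N \<alpha>. N \<ge> 1 \<Longrightarrow>
      norm ((1 / of_nat N) * (\<Sum>n<N. f n * e (real n * \<alpha>))) \<le> C0 * real N powr (- c)"
    using \<open>gelfond_type f\<close> unfolding gelfond_type_def by blast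
  define C where "C = \<bar>C0\<bar> + 1"
  have C: "C > 0" by (simp add: C_def)
  have gelfond: "norm ((1 / of_nat N) * (\<Sum>n<N. f n * e (real n * \<alpha>))) \<le> C * real N powr (- c)"
    if "N \<ge> 1" for N \<alpha>
  proof -
    have "C0 * real N powr (- c) \<le> C * real N powr (- c)" by (intro mult_right_mono) (auto simp: C_def)
    then show ?thesis using C0[OF that, of \<alpha>] by linarith
  qed
  \<comment> \<open>One difference more than the degree \<open>d\<close> calls for: then
    \<open>k\<close> is at least 2 even for \<open>d = 0\<close>, as the reduction to linear phases
    needs.\<close>
  define k where "k = d + 2"
  define \<kappa> where "\<kappa> = 1 / sqrt (real (q ^ d)) * (1 / 4)"
  have "1 \<le> q ^ d" using q by simp
  then have "1 \<le> sqrt (real (q ^ d))" by (simp del: of_nat_power)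
  moreover have "0 < 1 / s * (1 / 4) \<and> 1 / s * (1 / 4) \<le> 1" if "1 \<le> s" for s :: real
    using that by (simp add: divide_simps)
  ultimately have \<kappa>: "0 < \<kappa>" "\<kappa> \<le> 1" unfolding \<kappa>_def by blast+
  \<comment> \<open>\<open>w\<close> is taken so large that the carries, at most \<open>k\<close>,
    stay below \<open>Q\<close>, and that good blocks lose no more than a factor Q^(-c/2). This is
    possible because \<open>\<kappa>\<close> involves \<open>d\<close> but not
    \<open>w\<close>.\<close>
  obtain w where w: "max (real k) ((1 / \<kappa>) powr (2 / c)) < real q ^ w"
  proof -
    have "1 < real q" using q by simp
    then show ?thesis using real_arch_pow that by blast
  qed
  define Q where "Q = q ^ (w + d)"
  have "q ^ w \<le> Q" unfolding Q_def using q by (intro power_increasing) auto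
  then have wQ: "real q ^ w \<le> real Q" by (metis of_nat_le_iff of_nat_power)
  have "real k < real Q" and Q\<kappa>: "(1 / \<kappa>) powr (2 / c) \<le> real Q"
    using w wQ by (simp_all only: max_less_iff_conj) linarith+
  then have Qk: "k < Q" by simp
  have Q2: "Q \<ge> 2" using Qk by (simp add: k_def)
  have multQ: "q_multiplicative Q f" unfolding Q_def using mult by (rule q_multiplicative_power)
  have f0: "f 0 = 1" using q_multiplicative_0[OF mult uni] .
  have \<kappa>Q: "real Q powr (- c / 2) \<le> \<kappa>"
  proof -
    have "((1 / \<kappa>) powr (2 / c)) powr (c / 2) \<le> real Q powr (c / 2)"
      using Q\<kappa> c by (intro powr_mono2) auto
    then have "1 / \<kappa> \<le> real Q powr (c / 2)" using c \<kappa> by (simp add: powr_powr)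
    then show ?thesis using \<kappa> Q2 by (simp add: powr_minus_divide field_simps)
  qed
  \<comment> \<open>With this \<open>\<delta>\<close> the error condition of
    \<open>near_polynomial_lifts_frequencies\<close> holds with equality.\<close>
  define \<delta> where "\<delta> = 1 / (4 * real Q ^ (2 * d + 1))"
  have "real Q ^ (2 * d + 1) \<ge> 1" using Q2 by (intro one_le_power) simp
  then have \<delta>: "\<delta> > 0" "\<delta> \<le> 1" "real Q ^ (2 * d + 1) * \<delta> \<le> 1 / 4" by (auto simp: \<delta>_def)
  define bad where "bad i \<longleftrightarrow> \<not> near_polynomial Q k \<delta> (\<lambda>n. f (Q ^ i * n))" for i
  have good: "lifts_frequencies (\<lambda>n. f (Q ^ i * n)) Q \<kappa>" if "\<not> bad i" for i
  proof -
    have "q_multiplicative q (\<lambda>n. f (Q ^ i * n))"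
      unfolding Q_def power_mult[symmetric] using q by (intro q_multiplicative_shift mult) auto
    moreover have "near_polynomial (q ^ (w + d)) (d + 2) \<delta> (\<lambda>n. f (Q ^ i * n))"
      using that by (simp add: bad_def Q_def k_def)
    ultimately have "lifts_frequencies (\<lambda>n. f (Q ^ i * n)) (q ^ (w + d)) \<kappa>"
      unfolding \<kappa>_def using \<delta> uni q by (intro near_polynomial_lifts_frequencies) (auto simp: Q_def)
    then show ?thesis by (simp add: Q_def)
  qed
  define b where "b L = card {i\<in>{..<L}. bad i}" for L
  have count: "real Q powr (c * real L) \<le> C\<^sup>2 * real Q ^ b L" for L
    unfolding b_def by (rule gelfond_obstruction_count[OF multQ Q2 f0 uni gelfond good \<kappa>Q \<kappa>(2)])
  define D where "D = real Q ^ Suc k"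
  have D: "D \<ge> 1" unfolding D_def using Q2 by (intro one_le_power) simp
  \<comment> \<open>\<open>\<theta>\<close> solves D^2 \<theta>^2 = D^2 - \<delta>^2/4, the loss
    over two blocks.\<close>
  define \<theta> where "\<theta> = sqrt (1 - \<delta>\<^sup>2 / (4 * D\<^sup>2))"
  have "\<delta>\<^sup>2 \<le> 1" using \<delta> by (simp add: power_le_one)
  moreover have "D\<^sup>2 \<ge> 1" using D by simp
  ultimately have "\<delta>\<^sup>2 < 4 * D\<^sup>2" by linarith
  then have lt: "\<delta>\<^sup>2 / (4 * D\<^sup>2) < 1" "0 < \<delta>\<^sup>2 / (4 * D\<^sup>2)" using D \<delta> by (auto simp: divide_simps)
  then have \<theta>: "0 < \<theta>" "\<theta> < 1" "\<theta>\<^sup>2 = 1 - \<delta>\<^sup>2 / (4 * D\<^sup>2)" unfolding \<theta>_def by auto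
  have D\<theta>: "D\<^sup>2 - \<delta>\<^sup>2 / 4 \<le> D\<^sup>2 * \<theta>\<^sup>2" using D unfolding \<theta>(3) by (simp add: right_diff_distrib)
  \<comment> \<open>Writing \<open>\<theta>\<close> as a power of \<open>Q\<close> turns the count
    of bad blocks into a bound for \<open>\<theta> ^ b L\<close> by a constant times
    \<open>\<sigma> ^ L\<close>.\<close>
  define \<tau> where "\<tau> = - log (real Q) \<theta>"
  have \<tau>: "\<tau> > 0" "\<theta> = real Q powr (- \<tau>)" using \<theta> Q2 by (auto simp: \<tau>_def)
  define \<sigma> where "\<sigma> = real Q powr (- (c * \<tau>))"
  have \<sigma>: "0 < \<sigma>" "\<sigma> < 1" using \<tau>(1) c Q2 by (auto simp: \<sigma>_def powr_less_one)
  \<comment> \<open>The division by \<open>\<theta>\<close> makes up for block 0, which the strict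
    window of the contraction estimate omits.\<close>
  define E where "E = (C\<^sup>2) powr \<tau> / \<theta>"
  have E: "E > 0" using \<theta> C by (simp add: E_def)
  have theta_b: "\<theta> ^ b L \<le> (C\<^sup>2) powr \<tau> * \<sigma> ^ L" for L
  proof -
    have "\<theta> ^ b L = (real Q ^ b L) powr (- \<tau>)"
      using Q2 by (simp add: \<tau>(2) powr_power powr_realpow[symmetric] powr_powr mult.commute)
    also have "\<dots> \<le> (real Q powr (c * real L) / C\<^sup>2) powr (- \<tau>)"
      using count[of L] C \<tau>(1) Q2 by (intro powr_mono2') (auto simp: field_simps)
    also have "\<dots> = (C\<^sup>2) powr \<tau> * \<sigma> ^ L"
      using C Q2 by (simp add: powr_divide powr_powr powr_minus_divide[of "C\<^sup>2"] \<sigma>_def powr_power mult_ac)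
    finally show ?thesis .
  qed
  define K where "K = (2::nat) ^ (d + 2)"
  have K: "K > 0" by (simp add: K_def)
  have main: "norm (\<Sum>n<Q ^ L. f n * e (poly p (real n))) \<le> (2 * root K E) * (root K \<sigma>) ^ L * real (Q ^ L)"
    if "degree p \<le> d" for p L
  proof -
    let ?N = "int Q ^ L"
    define S where "S = norm (\<Sum>n<Q ^ L. f n * e (poly p (real n)))"
    have N: "real_of_int ?N > 0" using Q2 by simp
    have "degree_at_most (d + 1) (\<lambda>n. poly p (of_int n))" using that by (intro degree_at_most_poly) simp
    then have "(norm (\<Sum>n\<in>{-?N..<?N}. digit_window f Q 0 L n * e (poly p (of_int n))) / (2 * of_int ?N)) ^ (2 ^ Suc (d + 1))
        \<le> Re (cube_sum {-?N..<?N} (Suc (d + 1)) (\<lambda>_. digit_window f Q 0 L)) / (2 * of_int ?N) ^ (d + 1 + 2)"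
      using Q2 by (intro van_der_corput) (auto simp: digit_window_def)
    then have "(S / (2 * of_int ?N)) ^ K \<le> Re (carry_sum f Q k 0 L (\<lambda>_. 0)) / (2 * of_int ?N) ^ Suc k"
      unfolding sum_digit_window S_def[symmetric] by (simp add: carry_sum_def k_def K_def)
    also have "\<dots> \<le> (2 ^ Suc k * D ^ L * \<theta> ^ card {j\<in>{0<..<0 + L}. bad j}) / (2 * of_int ?N) ^ Suc k"
    proof (intro divide_right_mono)
      have "norm (carry_sum f Q k 0 L (\<lambda>_. 0)) \<le> 2 ^ Suc k * D ^ L * \<theta> ^ card {j\<in>{0<..<0 + L}. bad j}"
        unfolding D_def
        by (rule carry_sum_contraction[OF multQ uni Qk \<delta>(1) bad_def])
          (use \<theta> D\<theta> in \<open>auto simp: D_def\<close>)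
      then show "Re (carry_sum f Q k 0 L (\<lambda>_. 0)) \<le> 2 ^ Suc k * D ^ L * \<theta> ^ card {j\<in>{0<..<0 + L}. bad j}"
        using complex_Re_le_cmod order_trans by blast
    qed (use N in auto)
    also have "\<dots> = \<theta> ^ card {j\<in>{0<..<0 + L}. bad j}"
    proof -
      have eq: "2 ^ Suc k * D ^ L = (2 * real_of_int ?N) ^ Suc k"
        by (simp only: D_def power_mult_distrib of_int_power of_int_of_nat_eq power_mult[symmetric] mult.commute)
      have "2 * real_of_int ?N \<noteq> 0" using N by linarith
      then have "(2 * real_of_int ?N) ^ Suc k \<noteq> 0" by (rule power_not_zero)
      then show ?thesis unfolding eq by (rule nonzero_mult_div_cancel_left)
    qed
    also have "\<dots> \<le> \<theta> ^ b L / \<theta>"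
    proof -
      have "{i\<in>{..<L}. bad i} \<subseteq> {0} \<union> {j\<in>{0<..<0 + L}. bad j}" by auto
      then have "b L \<le> card ({0} \<union> {j\<in>{0<..<0 + L}. bad j})" unfolding b_def by (intro card_mono) auto
      also have "\<dots> \<le> card {0::nat} + card {j\<in>{0<..<0 + L}. bad j}" by (rule card_Un_le)
      finally have "\<theta> ^ Suc (card {j\<in>{0<..<0 + L}. bad j}) \<le> \<theta> ^ b L"
        using \<theta> by (intro power_decreasing) auto
      then show ?thesis using \<theta> by (simp add: pos_le_divide_eq mult.commute)
    qed
    also have "\<dots> \<le> E * \<sigma> ^ L"
      using theta_b[of L] \<theta> by (simp add: E_def divide_right_mono)
    finally have "root K ((S / (2 * of_int ?N)) ^ K) \<le> root K (E * \<sigma> ^ L)"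
      using K by simp
    moreover have "root K ((S / (2 * of_int ?N)) ^ K) = S / (2 * of_int ?N)"
      using K N by (intro real_root_power_cancel) (auto simp: S_def)
    moreover have "root K (E * \<sigma> ^ L) = root K E * (root K \<sigma>) ^ L"
      using K \<sigma> by (simp add: real_root_mult real_root_power)
    ultimately have "S / (2 * of_int ?N) \<le> root K E * (root K \<sigma>) ^ L" by simp
    then have "S \<le> root K E * (root K \<sigma>) ^ L * (2 * of_int ?N)"
      using N by (subst (asm) pos_divide_le_eq) auto
    then show ?thesis by (simp add: S_def mult_ac)
  qed
  have "0 < root K \<sigma>" "root K \<sigma> < 1" "0 \<le> 2 * root K E" using K \<sigma> E by auto
  then show ?thesis using Q2 multQ main by blast
qed

subsection \<open>Passage to measure-preserving systems\<close>

lemma mps_funpow: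
  assumes "mps M T"
  shows "T ^^ n \<in> measurable M M" "distr M M (T ^^ n) = M"
proof -
  have T: "T \<in> measurable M M" "distr M M T = M" using assms by (auto simp: mps_def)
  have "T ^^ n \<in> measurable M M \<and> distr M M (T ^^ n) = M"
  proof (induction n)
    case 0
    show ?case by (simp add: id_def distr_id)
  next
    case (Suc n)
    then have "distr M M (T \<circ> T ^^ n) = distr (distr M M (T ^^ n)) M T"
      using T(1) by (intro distr_distr[symmetric]) auto
    also have "\<dots> = M" using Suc T(2) by simp
    finally have "distr M M (T \<circ> T ^^ n) = M" .
    moreover have "T \<circ> T ^^ n \<in> measurable M M" using Suc T(1) by (intro measurable_comp) auto
    ultimately show ?case by (simp only: funpow.simps)
  qed
  then show "T ^^ n \<in> measurable M M" "distr M M (T ^^ n) = M" by auto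
qed

lemma mps_integral_funpow:
  fixes h :: "'a \<Rightarrow> real"
  assumes "mps M T" "h \<in> borel_measurable M"
  shows "integral\<^sup>L M (\<lambda>x. h ((T ^^ n) x)) = integral\<^sup>L M h"
  using integral_distr[of "T ^^ n" M M h] mps_funpow[OF assms(1), of n] assms(2) by simp

lemma mps_integrable_funpow:
  fixes h :: "'a \<Rightarrow> real"
  assumes "mps M T" "integrable M h"
  shows "integrable M (\<lambda>x. h ((T ^^ n) x))"
  using integrable_distr_eq[of "T ^^ n" M M h] mps_funpow[OF assms(1), of n] assms(2)
  by (simp add: borel_measurable_integrable)

lemma mps_measurable_funpow:
  assumes "mps M T" "h \<in> borel_measurable M"
  shows "(\<lambda>x. h ((T ^^ n) x)) \<in> borel_measurable M"
  using measurable_compose[OF mps_funpow(1)[OF assms(1)] assms(2)] .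

text \<open>Averaging over the first \<open>L\<close> points of an orbit replaces the spectral theorem.\<close>

lemma ergodic_sum_l1_bound:
  fixes a :: "nat \<Rightarrow> complex" and G :: "'a \<Rightarrow> complex"
  assumes mps: "mps M T" and G: "G \<in> borel_measurable M" "\<And>x. norm (G x) \<le> K"
    and bound: "\<And>\<alpha>. norm (\<Sum>n<N. a n * e (real (p n) * \<alpha>)) \<le> \<Lambda>"
  shows "integrable M (\<lambda>x. norm (\<Sum>n<N. a n * G ((T ^^ p n) x)))"
    and "integral\<^sup>L M (\<lambda>x. norm (\<Sum>n<N. a n * G ((T ^^ p n) x))) \<le> sqrt 2 * \<Lambda> * K"
proof -
  interpret prob_space M using mps by (simp add: mps_def)
  define X where "X x = norm (\<Sum>n<N. a n * G ((T ^^ p n) x))" for x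
  have meas [measurable]: "X \<in> borel_measurable M"
    unfolding X_def using mps_measurable_funpow[OF mps G(1)] by measurable
  have X0: "X x \<ge> 0" for x by (simp add: X_def)
  define B where "B = (\<Sum>n<N. norm (a n) * K)"
  have XB: "X x \<le> B" for x
    unfolding X_def B_def by (intro sum_norm_le) (simp add: norm_mult G(2) mult_left_mono)
  have intX: "integrable M X"
    by (rule integrable_const_bound[where B = B]) (use XB X0 in auto)
  have intX2: "integrable M (\<lambda>x. (X x)\<^sup>2)"
    by (rule integrable_const_bound[where B = "B\<^sup>2"]) (use XB X0 in \<open>auto intro: power_mono\<close>)
  \<comment> \<open>\<open>L\<close> exceeds every exponent \<open>p n\<close>, so all points used
    lie among the first \<open>2 * L\<close> of the orbit; this is the origin of the factor
    2.\<close>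
  define L where "L = Suc (\<Sum>n<N. p n)"
  have pL: "p n < L" if "n < N" for n
    using member_le_sum[of n "{..<N}" p] that by (simp add: L_def)
  have \<Lambda>0: "\<Lambda> \<ge> 0" using order_trans[OF norm_ge_zero bound] .
  have K0: "K \<ge> 0" using order_trans[OF norm_ge_zero G(2)] .
  have pw: "(\<Sum>l<L. (X ((T ^^ l) x))\<^sup>2) \<le> \<Lambda>\<^sup>2 * (real (2 * L) * K\<^sup>2)" for x
  proof -
    have "(T ^^ p n) ((T ^^ l) x) = (T ^^ (l + p n)) x" for n l
      by (subst add.commute) (simp add: funpow_add)
    then have "(\<Sum>l<L. (X ((T ^^ l) x))\<^sup>2) = (\<Sum>l<L. norm (\<Sum>n<N. a n * G ((T ^^ (l + p n)) x)) ^ 2)"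
      by (simp add: X_def)
    also have "\<dots> \<le> \<Lambda>\<^sup>2 * (\<Sum>l<2 * L. norm (G ((T ^^ l) x)) ^ 2)"
    proof (rule convolution_bound_l2[OF bound])
      show "l + p n < 2 * L" if "n < N" "l < L" for n l using pL[OF that(1)] that(2) by simp
    qed (auto simp: L_def)
    also have "\<dots> \<le> \<Lambda>\<^sup>2 * (\<Sum>l<2 * L. K\<^sup>2)"
      by (intro mult_left_mono sum_mono power_mono G(2)) auto
    finally show ?thesis by simp
  qed
  \<comment> \<open>Invariance of the measure makes all \<open>L\<close> integrals equal, so the
    orbitwise bound can be integrated.\<close>
  have "real L * integral\<^sup>L M (\<lambda>x. (X x)\<^sup>2) = (\<Sum>l<L. integral\<^sup>L M (\<lambda>x. (X ((T ^^ l) x))\<^sup>2))"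
    using mps_integral_funpow[OF mps, of "\<lambda>x. (X x)\<^sup>2"] by simp
  also have "\<dots> = integral\<^sup>L M (\<lambda>x. \<Sum>l<L. (X ((T ^^ l) x))\<^sup>2)"
    using mps_integrable_funpow[OF mps intX2] by (intro Bochner_Integration.integral_sum[symmetric])
  also have "\<dots> \<le> integral\<^sup>L M (\<lambda>x. \<Lambda>\<^sup>2 * (real (2 * L) * K\<^sup>2))"
    using mps_integrable_funpow[OF mps intX2] pw by (intro integral_mono) auto
  also have "\<dots> = real L * (2 * \<Lambda>\<^sup>2 * K\<^sup>2)" by (simp add: prob_space)
  finally have "integral\<^sup>L M (\<lambda>x. (X x)\<^sup>2) \<le> 2 * \<Lambda>\<^sup>2 * K\<^sup>2"
    by (rule mult_left_le_imp_le) (simp only: L_def of_nat_0_less_iff zero_less_Suc)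
  moreover have "(integral\<^sup>L M X)\<^sup>2 \<le> integral\<^sup>L M (\<lambda>x. (X x)\<^sup>2)"
    using variance_eq[OF intX intX2] variance_positive[of X] by simp
  ultimately have "(integral\<^sup>L M X)\<^sup>2 \<le> (sqrt 2 * \<Lambda> * K)\<^sup>2"
    by (simp add: power_mult_distrib)
  then have "integral\<^sup>L M X \<le> sqrt 2 * \<Lambda> * K"
    by (rule power2_le_imp_le) (intro mult_nonneg_nonneg \<Lambda>0 K0, simp)
  then show "integral\<^sup>L M (\<lambda>x. norm (\<Sum>n<N. a n * G ((T ^^ p n) x))) \<le> sqrt 2 * \<Lambda> * K"
    "integrable M (\<lambda>x. norm (\<Sum>n<N. a n * G ((T ^^ p n) x)))"
    using intX by (simp_all only: X_def[abs_def])
qed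

text \<open>Monotone convergence makes the sum of the \<open>X j\<close> finite almost everywhere,
  so its terms tend to 0.\<close>

lemma AE_tendsto_0_if_summable_l1:
  fixes X :: "nat \<Rightarrow> 'a \<Rightarrow> real"
  assumes int: "\<And>j. integrable M (X j)" and nonneg: "\<And>j x. X j x \<ge> 0"
    and le: "\<And>j. integral\<^sup>L M (X j) \<le> u j" and "summable u"
  shows "AE x in M. (\<lambda>j. X j x) \<longlonglongrightarrow> 0"
proof -
  have u0: "u j \<ge> 0" for j
    by (rule order_trans[OF _ le[of j]]) (rule Bochner_Integration.integral_nonneg[OF nonneg])
  have "(\<integral>\<^sup>+x. (\<Sum>j. ennreal (X j x)) \<partial>M) = (\<Sum>j. \<integral>\<^sup>+x. ennreal (X j x) \<partial>M)"
    using int by (intro nn_integral_suminf) auto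
  also have "\<dots> \<le> (\<Sum>j. ennreal (u j))"
  proof (intro suminf_le)
    fix j
    have "(\<integral>\<^sup>+x. ennreal (X j x) \<partial>M) = ennreal (integral\<^sup>L M (X j))"
      using int nonneg by (intro nn_integral_eq_integral) auto
    then show "(\<integral>\<^sup>+x. ennreal (X j x) \<partial>M) \<le> ennreal (u j)"
      using le by (simp add: ennreal_leI)
  qed auto
  also have "\<dots> = ennreal (\<Sum>j. u j)" using u0 \<open>summable u\<close> by (intro suminf_ennreal2) auto
  finally have "(\<integral>\<^sup>+x. (\<Sum>j. ennreal (X j x)) \<partial>M) \<noteq> \<infinity>"
    by (auto simp: top_unique)
  then have "AE x in M. (\<Sum>j. ennreal (X j x)) \<noteq> \<infinity>"
    using int by (intro nn_integral_PInf_AE) auto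
  then show ?thesis
  proof eventually_elim
    case (elim x)
    then have "summable (\<lambda>j. X j x)" using nonneg by (intro summable_suminf_not_top) auto
    then show ?case by (rule summable_LIMSEQ_zero)
  qed
qed

text \<open>Every large \<open>N\<close> lies between two consecutive powers of Q^2, so normalising
  by \<open>N\<close> instead of the upper power loses at most a factor Q^2.\<close>

lemma tendsto_0_of_block_bounds:
  fixes S :: "nat \<Rightarrow> complex" and H :: "nat \<Rightarrow> real"
  assumes "Q \<ge> 2" and S: "\<And>N j. N \<le> Q ^ (2 * j) \<Longrightarrow> norm (S N) \<le> H j"
    and lim: "(\<lambda>j. H j / real (Q ^ (2 * j))) \<longlonglongrightarrow> 0"
  shows "(\<lambda>N. (1 / of_nat N) * S N) \<longlonglongrightarrow> 0"
proof (rule LIMSEQ_I)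
  fix \<epsilon> :: real assume "\<epsilon> > 0"
  have Q: "real Q > 0" using assms(1) by simp
  then have "\<epsilon> / (real Q)\<^sup>2 > 0" using \<open>\<epsilon> > 0\<close> by simp
  then obtain J where J: "\<And>j. j \<ge> J \<Longrightarrow> \<bar>H j / real (Q ^ (2 * j))\<bar> < \<epsilon> / (real Q)\<^sup>2"
    using LIMSEQ_D[OF lim] by fastforce
  show "\<exists>N0. \<forall>N\<ge>N0. norm ((1 / of_nat N) * S N - 0) < \<epsilon>"
  proof (intro exI allI impI)
    fix N assume N: "N \<ge> Suc (Q ^ (2 * J))"
    have "N \<le> Q ^ (2 * N)"
    proof -
      have "N < 2 ^ N" by (rule less_exp)
      also have "(2::nat) ^ N \<le> 2 ^ (2 * N)" by (intro power_increasing) auto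
      also have "\<dots> \<le> Q ^ (2 * N)" using assms(1) by (intro power_mono) auto
      finally show ?thesis by simp
    qed
    define j where "j = (LEAST j. N \<le> Q ^ (2 * j))"
    have j: "N \<le> Q ^ (2 * j)" unfolding j_def by (rule LeastI) fact
    have "J < j"
    proof (rule ccontr)
      assume "\<not> J < j"
      then have "Q ^ (2 * j) \<le> Q ^ (2 * J)" using assms(1) by (intro power_increasing) auto
      then show False using j N by simp
    qed
    then obtain i where i: "j = Suc i" by (cases j) auto
    have "\<not> N \<le> Q ^ (2 * i)" using not_less_Least[of i "\<lambda>j. N \<le> Q ^ (2 * j)"] by (simp add: j_def[symmetric] i)
    then have "real (Q ^ (2 * i)) \<le> real N" by simp
    then have "real (Q ^ (2 * j)) \<le> (real Q)\<^sup>2 * real N"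
      using Q by (simp add: i power2_eq_square mult_ac)
    have N0: "real N > 0" using N by simp
    have "norm ((1 / of_nat N) * S N) = norm (S N) / real N" by (simp add: norm_divide)
    also have "\<dots> \<le> H j / real N" using S[OF j] by (intro divide_right_mono) auto
    also have "\<dots> = H j / real (Q ^ (2 * j)) * (real (Q ^ (2 * j)) / real N)" using Q by simp
    also have "\<dots> \<le> H j / real (Q ^ (2 * j)) * (real Q)\<^sup>2"
    proof (intro mult_left_mono)
      show "real (Q ^ (2 * j)) / real N \<le> (real Q)\<^sup>2"
        using N0 \<open>real (Q ^ (2 * j)) \<le> _\<close> by (subst pos_divide_le_eq) auto
      have "H j \<ge> 0" using order_trans[OF norm_ge_zero S[OF j]] .
      then show "0 \<le> H j / real (Q ^ (2 * j))" by simp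
    qed
    also have "\<dots> < \<epsilon> / (real Q)\<^sup>2 * (real Q)\<^sup>2"
      using abs_less_iff[THEN iffD1, OF J[of j]] \<open>J < j\<close> Q by (intro mult_strict_right_mono) simp_all
    finally show "norm ((1 / of_nat N) * S N - 0) < \<epsilon>" using Q by simp
  qed
qed

section \<open>Almost everywhere convergence along polynomial orbits\<close>

theorem theoremC:
  fixes q :: nat and f :: "nat \<Rightarrow> complex" and p :: "real poly"
    and M :: "'a measure" and T :: "'a \<Rightarrow> 'a" and F :: "'a \<Rightarrow> complex" and r :: real
  assumes "q \<ge> 2"
    and "q_multiplicative q f"
    and "\<forall>n. norm (f n) = 1"
    and "gelfond_type f"
    and "\<forall>n::nat. poly p (real n) \<in> \<nat>"
    and "mps M T"
    and "r > 1"
    and "F \<in> borel_measurable M"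
    and "integrable M (\<lambda>x. norm (F x) powr r)"
  shows "AE x in M. (\<lambda>N. (1 / of_nat N) *
            (\<Sum>n<N. f n * F ((T ^^ nat \<lfloor>poly p (real n)\<rfloor>) x))) \<longlonglongrightarrow> 0"
proof -
  interpret prob_space M using \<open>mps M T\<close> by (simp add: mps_def)
  note mps = \<open>mps M T\<close>
  have uni: "norm (f n) = 1" for n using assms(3) by simp
  define pn where "pn n = nat \<lfloor>poly p (real n)\<rfloor>" for n
  have pn: "real (pn n) = poly p (real n)" for n
  proof -
    obtain m where "poly p (real n) = of_nat m" using assms(5) by (meson Nats_cases)
    then show ?thesis by (simp add: pn_def)
  qed
  obtain Q :: nat and C \<rho> :: real where Q: "Q \<ge> 2" and mult: "q_multiplicative Q f"
    and \<rho>: "0 < \<rho>" "\<rho> < 1" and C: "C \<ge> 0"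
    and weyl: "\<And>p' L. degree p' \<le> degree p \<Longrightarrow>
      norm (\<Sum>n<Q ^ L. f n * e (poly p' (real n))) \<le> C * \<rho> ^ L * real (Q ^ L)"
    using q_multiplicative_weyl_sum_bound[OF assms(2,1) uni assms(4), of "degree p"] by blast
  \<comment> \<open>On the block n = a + Q^j b the phase is again a polynomial in \<open>a\<close>
    of degree at most \<open>degree p\<close>; uniformity over polynomials makes the bound
    independent of \<open>b\<close> and \<open>\<alpha>\<close>.\<close>
  have phase: "norm (\<Sum>a<Q ^ j. f a * e (real (pn (a + Q ^ j * b)) * \<alpha>)) \<le> C * \<rho> ^ j * real (Q ^ j)" for j b \<alpha>
  proof -
    let ?p = "smult \<alpha> (pcompose p [:real (Q ^ j * b), 1:])"
    have deg: "degree ?p \<le> degree p"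
      using degree_smult_le[of \<alpha> "pcompose p [:real (Q ^ j * b), 1:]"] by (simp add: degree_pcompose)
    have "poly ?p (real a) = real (pn (a + Q ^ j * b)) * \<alpha>" for a
      unfolding pn by (simp add: poly_pcompose) (simp add: add.commute)
    then show ?thesis using weyl[OF deg, of j] by (simp only:)
  qed
  \<comment> \<open>The truncation heights \<open>\<mu> ^ j\<close> must grow, but slower than
    (1/\<rho>)^j so that the power saving wins, and slower than Q^j so that an incomplete block is
    negligible.\<close>
  have "1 < min (1 / \<rho>) (real Q)" using \<rho> Q by simp
  then obtain \<mu> where \<mu>: "1 < \<mu>" "\<mu> < min (1 / \<rho>) (real Q)" using dense by blast
  have \<mu>\<rho>: "\<rho> * \<mu> < 1" using \<mu>(2) \<rho> by (simp add: field_simps)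
  define F1 where "F1 j x = (if norm (F x) \<le> \<mu> ^ j then F x else 0)" for j :: nat and x
  define F2 where "F2 j x = norm (F x - F1 j x)" for j x
  have Fm [measurable]: "F \<in> borel_measurable M" by fact
  have F1m [measurable]: "F1 j \<in> borel_measurable M" for j unfolding F1_def by measurable
  have F2m [measurable]: "F2 j \<in> borel_measurable M" for j unfolding F2_def by measurable
  have F1: "norm (F1 j x) \<le> \<mu> ^ j" for j x using \<mu>(1) by (simp add: F1_def)
  define I where "I = integral\<^sup>L M (\<lambda>x. norm (F x) powr r)"
  \<comment> \<open>Where |F| exceeds \<open>\<mu> ^ j\<close>, it is at most
    \<open>(\<mu> ^ j) powr (1 - r)\<close> times |F|^r; \<open>\<nu>\<close> is this gain per
    scale.\<close>
  define \<nu> where "\<nu> = \<mu> powr (1 - r)"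
  have \<nu>: "0 < \<nu>" "\<nu> < 1" using \<mu>(1) \<open>r > 1\<close> by (auto simp: \<nu>_def powr_less_one)
  have F2: "F2 j x \<le> \<nu> ^ j * norm (F x) powr r" for j x
  proof (cases "norm (F x) \<le> \<mu> ^ j")
    case True
    then show ?thesis using \<nu> by (simp add: F2_def F1_def)
  next
    case False
    have pos: "\<mu> ^ j > 0" using \<mu>(1) by simp
    have "norm (F x) = norm (F x) powr (1 - r) * norm (F x) powr r"
      using False pos by (simp add: powr_add[symmetric])
    also have "\<dots> \<le> (\<mu> ^ j) powr (1 - r) * norm (F x) powr r"
      using False pos \<open>r > 1\<close> by (intro mult_right_mono powr_mono2') auto
    also have "(\<mu> ^ j) powr (1 - r) = \<nu> ^ j"
      using \<mu>(1) by (simp add: \<nu>_def powr_realpow[symmetric] powr_powr mult.commute)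
    finally show ?thesis using False by (simp add: F2_def F1_def)
  qed
  have intF2: "integrable M (F2 j)" for j
  proof (rule Bochner_Integration.integrable_bound)
    show "integrable M (\<lambda>x. \<nu> ^ j * norm (F x) powr r)" using assms(9) by simp
    show "AE x in M. norm (F2 j x) \<le> norm (\<nu> ^ j * norm (F x) powr r)"
      using F2[of j] \<nu> by (intro AE_I2) (auto simp: F2_def abs_mult)
  qed simp
  have EF2: "integral\<^sup>L M (F2 j) \<le> \<nu> ^ j * I" for j
  proof -
    have "integral\<^sup>L M (F2 j) \<le> integral\<^sup>L M (\<lambda>x. \<nu> ^ j * norm (F x) powr r)"
      using intF2 assms(9) F2 by (intro integral_mono) auto
    then show ?thesis by (simp add: I_def)
  qed
  define bl where "bl j b x = norm (\<Sum>a<Q ^ j. f a * F1 j ((T ^^ pn (a + Q ^ j * b)) x))" for j b x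
  have intbl: "integrable M (bl j b)"
    and Ebl: "integral\<^sup>L M (bl j b) \<le> sqrt 2 * (C * \<rho> ^ j * real (Q ^ j)) * \<mu> ^ j" for j b
    unfolding bl_def by (rule ergodic_sum_l1_bound[OF mps F1m F1 phase])+
  \<comment> \<open>\<open>H j\<close> is to bound the sums for all \<open>N\<close> up to
    \<open>Q ^ (2 * j)\<close> at once: the part of \<open>F\<close> removed by truncation, the
    complete blocks of length \<open>Q ^ j\<close> in absolute value, and one incomplete block
    estimated trivially.\<close>
  define H where "H j x = (\<Sum>n<Q ^ (2 * j). F2 j ((T ^^ pn n) x)) + (\<Sum>b<Q ^ j. bl j b x) + real (Q ^ j) * \<mu> ^ j" for j x
  have H0: "H j x \<ge> 0" for j x
    unfolding H_def using \<mu>(1) by (intro add_nonneg_nonneg sum_nonneg) (auto simp: F2_def bl_def)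
  have intH: "integrable M (H j)" for j
    unfolding H_def[abs_def]
    using mps_integrable_funpow[OF mps intF2] intbl by (intro Bochner_Integration.integrable_add Bochner_Integration.integrable_sum) auto
  have EH: "integral\<^sup>L M (\<lambda>x. H j x / real (Q ^ (2 * j)))
      \<le> I * \<nu> ^ j + sqrt 2 * C * (\<rho> * \<mu>) ^ j + (\<mu> / real Q) ^ j" for j
  proof -
    have "integral\<^sup>L M (H j) = (\<Sum>n<Q ^ (2 * j). integral\<^sup>L M (\<lambda>x. F2 j ((T ^^ pn n) x)))
        + (\<Sum>b<Q ^ j. integral\<^sup>L M (bl j b)) + real (Q ^ j) * \<mu> ^ j"
      unfolding H_def[abs_def]
      using mps_integrable_funpow[OF mps intF2] intbl by (simp add: prob_space)
    also have "\<dots> \<le> (\<Sum>n<Q ^ (2 * j). \<nu> ^ j * I)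
        + (\<Sum>b<Q ^ j. sqrt 2 * (C * \<rho> ^ j * real (Q ^ j)) * \<mu> ^ j) + real (Q ^ j) * \<mu> ^ j"
      unfolding mps_integral_funpow[OF mps F2m]
      by (intro add_mono sum_mono EF2 Ebl order_refl)
    also have "\<dots> = real (Q ^ (2 * j)) * (I * \<nu> ^ j + sqrt 2 * C * (\<rho> * \<mu>) ^ j + (\<mu> / real Q) ^ j)"
    proof -
      have "real Q ^ (2 * j) = real Q ^ j * real Q ^ j" by (simp add: mult_2 power_add)
      then show ?thesis using Q by (simp add: power_mult_distrib power_divide algebra_simps)
    qed
    finally show ?thesis using Q by (simp add: divide_le_eq mult.commute)
  qed
  have "summable (\<lambda>j. I * \<nu> ^ j + sqrt 2 * C * (\<rho> * \<mu>) ^ j + (\<mu> / real Q) ^ j)"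
    using \<nu> \<mu> \<mu>\<rho> \<rho> Q by (intro summable_add summable_mult summable_geometric) auto
  then have lim: "AE x in M. (\<lambda>j. H j x / real (Q ^ (2 * j))) \<longlonglongrightarrow> 0"
    using intH H0 EH by (intro AE_tendsto_0_if_summable_l1[where u = "\<lambda>j. I * \<nu> ^ j + sqrt 2 * C * (\<rho> * \<mu>) ^ j + (\<mu> / real Q) ^ j"]) auto
  have bound: "norm (\<Sum>n<N. f n * F ((T ^^ pn n) x)) \<le> H j x" if N: "N \<le> Q ^ (2 * j)" for N j x
  proof -
    let ?q = "Q ^ j"
    let ?G = "\<lambda>n. f n * F1 j ((T ^^ pn n) x)"
    define B where "B = N div ?q"
    have q0: "?q > 0" using Q by simp
    have "B \<le> (?q * ?q) div ?q" unfolding B_def using N by (intro div_le_mono) (simp add: mult_2 power_add)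
    then have B: "B \<le> ?q" using q0 by (simp split: if_splits)
    have BN: "?q * B \<le> N" "N \<le> ?q * B + ?q"
      using q0 mult_div_mod_eq[of ?q N] mod_less_divisor[OF q0, of N] unfolding B_def by linarith+
    have eq: "f n * F ((T ^^ pn n) x) = f n * (F ((T ^^ pn n) x) - F1 j ((T ^^ pn n) x)) + ?G n" for n
      by (simp add: algebra_simps)
    have "norm (\<Sum>n<N. f n * F ((T ^^ pn n) x))
        \<le> norm (\<Sum>n<N. f n * (F ((T ^^ pn n) x) - F1 j ((T ^^ pn n) x))) + norm (\<Sum>n<N. ?G n)"
      unfolding eq sum.distrib by (rule norm_triangle_ineq)
    also have "norm (\<Sum>n<N. f n * (F ((T ^^ pn n) x) - F1 j ((T ^^ pn n) x))) \<le> (\<Sum>n<N. F2 j ((T ^^ pn n) x))"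
      by (intro sum_norm_le) (simp add: norm_mult uni F2_def)
    also have "\<dots> \<le> (\<Sum>n<Q ^ (2 * j). F2 j ((T ^^ pn n) x))"
      using N by (intro sum_mono2) (auto simp: F2_def)
    also have "(\<Sum>n<N. ?G n) = (\<Sum>n<?q * B. ?G n) + (\<Sum>n\<in>{?q * B..<N}. ?G n)"
      using BN(1) by (subst sum.union_disjoint[symmetric]) (auto intro!: sum.cong)
    also have "norm \<dots> \<le> norm (\<Sum>n<?q * B. ?G n) + norm (\<Sum>n\<in>{?q * B..<N}. ?G n)"
      by (rule norm_triangle_ineq)
    also have "norm (\<Sum>n\<in>{?q * B..<N}. ?G n) \<le> (\<Sum>n\<in>{?q * B..<N}. \<mu> ^ j)"
      by (intro sum_norm_le) (simp add: norm_mult uni F1)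
    also have "\<dots> \<le> real ?q * \<mu> ^ j"
    proof -
      have "N - ?q * B \<le> ?q" using BN by linarith
      then have "real (N - ?q * B) \<le> real ?q" by (rule of_nat_mono)
      then show ?thesis using \<mu>(1) by (simp add: mult_right_mono)
    qed
    also have "norm (\<Sum>n<?q * B. ?G n) \<le> (\<Sum>b<B. bl j b x)"
      unfolding sum_lessThan_mult_split
    proof (rule sum_norm_le)
      fix b
      \<comment> \<open>Within block \<open>b\<close> multiplicativity pulls out
        \<open>f (?q * b)\<close>, of modulus one, so the block sum has exactly the size recorded in
        \<open>bl\<close>.\<close>
      have "f (a + ?q * b) = f (?q * b) * f a" if "a < ?q" for a
        using q_multiplicativeD[OF mult that, of b] by (simp add: mult.commute)
      then have "(\<Sum>a<?q. ?G (a + ?q * b)) = f (?q * b) * (\<Sum>a<?q. f a * F1 j ((T ^^ pn (a + ?q * b)) x))"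
        unfolding sum_distrib_left by (intro sum.cong refl) simp
      then show "norm (\<Sum>a<?q. ?G (a + ?q * b)) \<le> bl j b x" by (simp add: bl_def norm_mult uni)
    qed
    also have "\<dots> \<le> (\<Sum>b<?q. bl j b x)" using B by (intro sum_mono2) (auto simp: bl_def)
    finally show ?thesis by (simp add: H_def add.assoc)
  qed
  show ?thesis
    unfolding pn_def[symmetric]
    using lim by (rule eventually_mono) (rule tendsto_0_of_block_bounds[OF Q bound])
qed

end
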